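(* Let $\mu\in M(\mathbb{T}^d)$ and let $\Lambda\subseteq\mathbb{Z}^d$ be a finite subset. Suppose there exists $n\in\Lambda$ such that $\widehat{M_{-n}\mu}\mid_{\Lambda-n}$ extends to a positive-definite sequence on $\mathbb{Z}^d$. Then $n\in\Gamma(\mu,\Lambda)$, and each positive-definite extension $\{a_m\}_{m\in\mathbb{Z}^d}$ of $\widehat{M_{-n}\mu}\mid_{\Lambda-n}$ corresponds to a positive measure $\nu\in M(\mathbb{T}^d)$ (that is, $\widehat\nu(m)=a_m$ for all $m\in\mathbb{Z}^d$) such that $M_n\nu$ is a minimal extrapolation of $\mu$ from $\Lambda$.
   Context: $\mathbb{T}^d=(\mathbb{R}/\mathbb{Z})^d$, and $M(\mathbb{T}^d)$ is the space of complex bounded Radon measures on $\mathbb{T}^d$ with the total variation norm $\|\cdot\|$. For $\mu\in M(\mathbb{T}^d)$ and $m\in\mathbb{Z}^d$, $\widehat\mu(m)=\int_{\mathbb{T}^d}e^{-2\pi i m\cdot x}\,d\mu(x)$. A measure $\nu$ is positive if $\nu(A)\geq 0$ for all Borel sets $A\subseteq\mathbb{T}^d$. A sequence $\{a_m\in\mathbb{C}\colon m\in\mathbb{Z}^d\}$ is positive-definite if $\sum_{m,n\in\mathbb{Z}^d}a_{m-n}b_m\overline{b_n}\geq 0$ for all finitely supported sequences $\{b_m\in\mathbb{C}\colon m\in\mathbb{Z}^d\}$. For $n\in\mathbb{Z}^d$, $M_n\colon M(\mathbb{T}^d)\to M(\mathbb{T}^d)$ is the modulation operator $d(M_n\mu)(x)=e^{2\pi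 i n\cdot x}\,d\mu(x)$. $\Lambda-n=\{m-n\colon m\in\Lambda\}$. A measure $\nu\in M(\mathbb{T}^d)$ is an extrapolation of $\mu$ from $\Lambda$ if $\widehat\nu=\widehat\mu$ on $\Lambda$, and a minimal extrapolation if moreover $\|\nu\|$ is minimal among all extrapolations. $\varepsilon(\mu,\Lambda)$ denotes this minimal norm (which is attained), and $\Gamma(\mu,\Lambda)=\{m\in\Lambda\colon|\widehat\mu(m)|=\varepsilon(\mu,\Lambda)\}$. *)

theory Defs
  imports "HOL-Analysis.Analysis"
begin

section \<open>The torus \<open>(\<real>/\<int>)\<^sup>d\<close>\<close>

quotient_type circle = real / "\<lambda>x y. x - y \<in> \<int>"
proof (rule equivpI)
  show "reflp (\<lambda>x y::real. x - y \<in> \<int>)"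
    by (simp add: reflp_def)
  show "symp (\<lambda>x y::real. x - y \<in> \<int>)"
    by (metis (mono_tags, lifting) Ints_minus minus_diff_eq sympI)
  show "transp (\<lambda>x y::real. x - y \<in> \<int>)"
  proof (rule transpI)
    fix x y z :: real
    assume "x - y \<in> \<int>" "y - z \<in> \<int>"
    then have "(x - y) + (y - z) \<in> \<int>"
      by (rule Ints_add)
    then show "x - z \<in> \<int>"
      by simp
  qed
qed

instantiation circle :: topological_space
begin

definition open_circle :: "circle set \<Rightarrow> bool"
  where "open_circle U \<longleftrightarrow> open (abs_circle -` U)"

instance
proof
  show "open (UNIV :: circle set)"
    by (simp add: open_circle_def)
  show "open (S \<inter> T)" if "open S" "open T" for S T :: "circle set"
    using that by (simp add: open_circle_def open_Int)
  show "open (\<Union>K)" if "\<forall>S\<in>K. open S" for K :: "circle set set"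
    using that by (auto simp add: open_circle_def vimage_Union)
qed

end

text \<open>
  \<open>'d\<close> is a finite index type with \<open>d = CARD('d)\<close>; the type \<open>circle ^ 'd\<close> carries the product
  topology, and \<open>borel\<close> at this type is its Borel \<open>\<sigma>\<close>-algebra. The dual group is \<open>int ^ 'd\<close>.
\<close>

type_synonym 'd torus = "circle ^ 'd"

lift_definition circle_character :: "int \<Rightarrow> circle \<Rightarrow> complex"
  is "\<lambda>k t. exp (2 * of_real pi * \<i> * of_int k * of_real t)"
proof -
  fix k :: int and s t :: real
  assume "s - t \<in> \<int>"
  then obtain j where j: "s = t + of_int j"
    by (metis Ints_cases add.commute diff_add_cancel)
  have "2 * of_real pi * \<i> * of_int k * complex_of_real s =
      2 * of_real pi * \<i> * of_int k * of_real t + of_int (2 * (k * j)) * of_real pi * \<i>"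
    by (simp add: j algebra_simps)
  then show "exp (2 * of_real pi * \<i> * of_int k * complex_of_real s) =
      exp (2 * of_real pi * \<i> * of_int k * of_real t)"
    unfolding exp_eq by (intro exI[of _ "k * j"]) simp
qed

text \<open>
  \<open>e\<^sup>2\<^sup>\<pi>\<^sup>i\<^sup>m\<^sup>\<cdot>\<^sup>x\<close>: the dot product itself is only determined modulo \<open>\<int>\<close>, so the
  exponential is written as the product of its coordinate factors.
\<close>

definition character :: "int ^ 'd \<Rightarrow> 'd::finite torus \<Rightarrow> complex"
  where "character m x = (\<Prod>i\<in>UNIV. circle_character (m $ i) (x $ i))"


section \<open>Complex Radon measures\<close>

text \<open>
  A complex measure is a set function; only its values on Borel sets are meaningful. The last clause
  below is the Radon property, i.e. inner regularity of the variation with respect to compact sets.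
\<close>

definition variation :: "('a::topological_space set \<Rightarrow> complex) \<Rightarrow> 'a set \<Rightarrow> ennreal"
  where "variation \<mu> A =
    (SUP P \<in> {P. finite P \<and> P \<subseteq> sets borel \<and> partition_on A P}. \<Sum>E\<in>P. ennreal (norm (\<mu> E)))"

definition complex_radon_measures :: "('a::topological_space set \<Rightarrow> complex) set"
  where "complex_radon_measures = {\<mu>.
    (\<forall>E::nat \<Rightarrow> 'a set. range E \<subseteq> sets borel \<longrightarrow> disjoint_family E \<longrightarrow>
        (\<lambda>i. \<mu> (E i)) sums \<mu> (\<Union>i. E i)) \<and>
    variation \<mu> UNIV < \<infinity> \<and>
    (\<forall>A\<in>sets borel. \<forall>\<epsilon>>0. \<exists>K. compact K \<and> K \<in> sets borel \<and> K \<subseteq> A \<and> variation \<mu> (A - K) < \<epsilon>)}"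

definition tv_norm :: "('a::topological_space set \<Rightarrow> complex) \<Rightarrow> real"
  where "tv_norm \<mu> = enn2real (variation \<mu> UNIV)"

definition positive_measure :: "('a::topological_space set \<Rightarrow> complex) \<Rightarrow> bool"
  where "positive_measure \<mu> \<longleftrightarrow> (\<forall>A\<in>sets borel. \<mu> A \<in> \<real>\<^sub>\<ge>\<^sub>0)"

text \<open>
  The integral against a complex measure is defined by Jordan decomposition of its real and
  imaginary parts. For a signed measure \<open>\<sigma>\<close> the positive part is
  \<open>\<sigma>\<^sup>+(A) = sup {\<sigma>(B) | B \<subseteq> A}\<close> and the negative part is \<open>(-\<sigma>)\<^sup>+\<close>; truncation by \<open>ennreal\<close> is
  harmless because \<open>B = {}\<close> is among the competitors.
\<close>

definition positive_part :: "('a::topological_space set \<Rightarrow> real) \<Rightarrow> 'a measure"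
  where "positive_part \<sigma> =
    measure_of UNIV (sets borel) (\<lambda>A. SUP B \<in> {B \<in> sets borel. B \<subseteq> A}. ennreal (\<sigma> B))"

definition signed_integral :: "('a::topological_space set \<Rightarrow> real) \<Rightarrow> ('a \<Rightarrow> complex) \<Rightarrow> complex"
  where "signed_integral \<sigma> f =
    integral\<^sup>L (positive_part \<sigma>) f - integral\<^sup>L (positive_part (\<lambda>A. - \<sigma> A)) f"

definition complex_integral :: "('a::topological_space set \<Rightarrow> complex) \<Rightarrow> ('a \<Rightarrow> complex) \<Rightarrow> complex"
  where "complex_integral \<mu> f =
    signed_integral (\<lambda>A. Re (\<mu> A)) f + \<i> * signed_integral (\<lambda>A. Im (\<mu> A)) f"


section \<open>Fourier coefficients and minimal extrapolation\<close>

definition fourier :: "('d::finite torus set \<Rightarrow> complex) \<Rightarrow> int ^ 'd \<Rightarrow> complex"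
  where "fourier \<mu> m = complex_integral \<mu> (character (- m))"

definition modulation ::
    "int ^ 'd \<Rightarrow> ('d::finite torus set \<Rightarrow> complex) \<Rightarrow> 'd torus set \<Rightarrow> complex"
  where "modulation n \<mu> A = complex_integral \<mu> (\<lambda>x. indicator A x * character n x)"

definition positive_definite :: "(int ^ 'd::finite \<Rightarrow> complex) \<Rightarrow> bool"
  where "positive_definite a \<longleftrightarrow>
    (\<forall>b. finite {m. b m \<noteq> 0} \<longrightarrow>
      (\<Sum>m\<in>{m. b m \<noteq> 0}. \<Sum>n\<in>{m. b m \<noteq> 0}. a (m - n) * b m * cnj (b n)) \<in> \<real>\<^sub>\<ge>\<^sub>0)"

definition extrapolations ::
    "('d::finite torus set \<Rightarrow> complex) \<Rightarrow> (int ^ 'd) set \<Rightarrow> ('d torus set \<Rightarrow> complex) set"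
  where "extrapolations \<mu> \<Lambda> = {\<nu> \<in> complex_radon_measures. \<forall>m\<in>\<Lambda>. fourier \<nu> m = fourier \<mu> m}"

definition minimal_extrapolation ::
    "('d::finite torus set \<Rightarrow> complex) \<Rightarrow> (int ^ 'd) set \<Rightarrow> ('d torus set \<Rightarrow> complex) \<Rightarrow> bool"
  where "minimal_extrapolation \<mu> \<Lambda> \<nu> \<longleftrightarrow>
    \<nu> \<in> extrapolations \<mu> \<Lambda> \<and> (\<forall>\<nu>'\<in>extrapolations \<mu> \<Lambda>. tv_norm \<nu> \<le> tv_norm \<nu>')"

definition minimal_norm :: "('d::finite torus set \<Rightarrow> complex) \<Rightarrow> (int ^ 'd) set \<Rightarrow> real"
  where "minimal_norm \<mu> \<Lambda> = (INF \<nu> \<in> extrapolations \<mu> \<Lambda>. tv_norm \<nu>)"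

definition Gamma_set :: "('d::finite torus set \<Rightarrow> complex) \<Rightarrow> (int ^ 'd) set \<Rightarrow> (int ^ 'd) set"
  where "Gamma_set \<mu> \<Lambda> = {m \<in> \<Lambda>. norm (fourier \<mu> m) = minimal_norm \<mu> \<Lambda>}"

definition extends_from :: "(int ^ 'd \<Rightarrow> complex) \<Rightarrow> (int ^ 'd) set \<Rightarrow> (int ^ 'd \<Rightarrow> complex) \<Rightarrow> bool"
  where "extends_from f S a \<longleftrightarrow> (\<forall>m\<in>S. a m = f m)"

end

theory Submission
  imports Defs "HOL-Probability.Probability"
begin

text \<open>
  Characters have modulus one, so every extrapolation \<open>\<nu>'\<close> of \<open>\<mu>\<close> satisfies
  \<open>\<bar>\<mu>^(n)\<bar> = \<bar>\<nu>'^(n)\<bar> \<le> \<parallel>\<nu>'\<parallel>\<close>: the number \<open>\<bar>\<mu>^(n)\<bar>\<close> is a lower bound for all norms that compete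
  in the minimum. Modulation shifts the Fourier transform, so a positive-definite extension \<open>a\<close> of
  the transform of \<open>M\<^sub>-\<^sub>n \<mu>\<close> has \<open>a(m - n) = \<mu>^(m)\<close> on \<open>\<Lambda>\<close>, in particular \<open>a(0) = \<mu>^(n)\<close>. If \<open>a\<close> is the
  Fourier transform of a positive measure \<open>\<nu>\<close>, then \<open>M\<^sub>n \<nu>\<close> is an extrapolation of \<open>\<mu>\<close> whose norm is at
  most the total mass \<open>a(0) = \<bar>\<mu>^(n)\<bar>\<close>. So the lower bound is attained, which gives \<open>n \<in> \<Gamma>\<close> and the
  minimality of \<open>M\<^sub>n \<nu>\<close> together.

  What remains is Herglotz' theorem on the torus (\<open>Herglotz_torus\<close>): a positive-definite sequence is
  the Fourier transform of a positive measure. Positive definiteness makes the Fejer means of \<open>a\<close>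
  nonnegative. Sampled on a finite grid they are weights whose discrete Fourier coefficients are those
  of \<open>a\<close>, damped by a factor that tends to one (\<open>discrete_Fejer_weights\<close>). The limit of these discrete
  measures is taken on the real line instead of the torus: a continuous curve \<open>torus_curve\<close> that
  passes through all grid points lifts them to probability measures on \<open>[0, 1]\<close>, the one-dimensional
  Helly selection theorem gives a weakly convergent subsequence, and the image of its limit under the
  curve is the required measure, because characters are continuous along the curve. The image
  measure is inner regular since measures on the line are (\<open>image_measure_inner_regular\<close>).

  The integral against a complex measure is handled through one principle
  (\<open>bounded_functional_eqI\<close>): a linear functional on the bounded Borel functions that is continuous in
  the supremum norm is determined by its values on indicators. It identifies integrals against
  modulated and against positive measures, and evaluation on simple functions gives the sharp bound
  \<open>\<bar>\<integral> f d\<mu>\<bar> \<le> sup \<bar>f\<bar> \<parallel>\<mu>\<parallel>\<close> (\<open>norm_complex_integral_le\<close>).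
\<close>

section \<open>Countably additive set functions and the Jordan decomposition\<close>

definition borel_sigma_additive ::
    "('a::topological_space set \<Rightarrow> 'b::real_normed_vector) \<Rightarrow> bool"
  where "borel_sigma_additive \<sigma> \<longleftrightarrow>
    (\<forall>E::nat \<Rightarrow> 'a set. range E \<subseteq> sets borel \<longrightarrow> disjoint_family E \<longrightarrow>
      (\<lambda>i. \<sigma> (E i)) sums \<sigma> (\<Union>i. E i))"

lemma borel_sigma_additiveD:
  fixes E :: "nat \<Rightarrow> 'a::topological_space set"
  assumes "borel_sigma_additive \<sigma>" "\<And>i. E i \<in> sets borel" "disjoint_family E"
  shows "(\<lambda>i. \<sigma> (E i)) sums \<sigma> (\<Union>i. E i)"
  using assms by (auto simp: borel_sigma_additive_def)

lemma borel_sigma_additive_empty: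
  assumes "borel_sigma_additive (\<sigma> :: 'a::topological_space set \<Rightarrow> 'b::real_normed_vector)"
  shows "\<sigma> {} = 0"
proof -
  have "(\<lambda>i::nat. \<sigma> {}) sums \<sigma> (\<Union>i::nat. {})"
    using assms by (rule borel_sigma_additiveD) (auto simp: disjoint_family_on_def)
  then have "summable (\<lambda>i::nat. \<sigma> {})"
    by (rule sums_summable)
  then show ?thesis
    by (simp add: summable_const_iff)
qed

lemma borel_sigma_additive_Un:
  assumes "borel_sigma_additive \<sigma>" "A \<in> sets borel" "B \<in> sets borel" "A \<inter> B = {}"
  shows "\<sigma> (A \<union> B) = \<sigma> A + \<sigma> B"
proof -
  have "(\<lambda>i. \<sigma> (binaryset A B i)) sums \<sigma> (\<Union>i. binaryset A B i)"
    using assms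
    by (intro borel_sigma_additiveD) (auto simp: binaryset_def disjoint_family_on_def)
  moreover have "(\<lambda>i. \<sigma> (binaryset A B i)) sums (\<sigma> A + \<sigma> B)"
    using assms(1) by (intro binaryset_sums borel_sigma_additive_empty)
  ultimately show ?thesis
    by (simp add: UN_binaryset_eq sums_unique2)
qed

lemma borel_sigma_additive_Diff:
  assumes "borel_sigma_additive \<sigma>" "A \<in> sets borel" "B \<in> sets borel" "B \<subseteq> A"
  shows "\<sigma> A = \<sigma> B + \<sigma> (A - B)"
  using borel_sigma_additive_Un[of \<sigma> B "A - B"] assms by (simp add: Un_absorb1)

lemma borel_sigma_additive_bounded_linear:
  assumes "bounded_linear L" "borel_sigma_additive \<sigma>"
  shows "borel_sigma_additive (\<lambda>A. L (\<sigma> A))"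
  using assms bounded_linear.sums unfolding borel_sigma_additive_def by blast

lemma borel_sigma_additive_finite_UN:
  assumes \<sigma>: "borel_sigma_additive \<sigma>" and "finite I" "\<And>i. i \<in> I \<Longrightarrow> E i \<in> sets borel"
    "disjoint_family_on E I"
  shows "\<sigma> (\<Union>i\<in>I. E i) = (\<Sum>i\<in>I. \<sigma> (E i))"
  using assms(2-)
proof (induction I rule: finite_induct)
  case empty
  then show ?case
    using borel_sigma_additive_empty[OF \<sigma>] by simp
next
  case (insert j I)
  have "E j \<inter> E i = {}" if "i \<in> I" for i
    using insert.hyps that by (intro disjoint_family_onD[OF insert.prems(2)]) auto
  then have "\<sigma> (E j \<union> (\<Union>i\<in>I. E i)) = \<sigma> (E j) + \<sigma> (\<Union>i\<in>I. E i)"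
    using insert by (intro borel_sigma_additive_Un[OF \<sigma>]) (auto intro!: sets.finite_UN)
  moreover have "\<sigma> (\<Union>i\<in>I. E i) = (\<Sum>i\<in>I. \<sigma> (E i))"
    using insert.prems by (intro insert.IH) (auto simp: disjoint_family_on_def)
  ultimately show ?case
    using insert.hyps by simp
qed

lemma borel_sigma_additive_lincomb:
  fixes \<sigma> \<tau> :: "'a::topological_space set \<Rightarrow> 'b::real_normed_field"
  assumes "borel_sigma_additive \<sigma>" "borel_sigma_additive \<tau>"
  shows "borel_sigma_additive (\<lambda>A. a * \<sigma> A + b * \<tau> A)"
  unfolding borel_sigma_additive_def
proof (intro allI impI)
  fix E :: "nat \<Rightarrow> 'a set"
  assume "range E \<subseteq> sets borel" "disjoint_family E"
  then show "(\<lambda>i. a * \<sigma> (E i) + b * \<tau> (E i)) sums (a * \<sigma> (\<Union>i. E i) + b * \<tau> (\<Union>i. E i))"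
    using assms by (intro sums_add sums_mult) (auto simp: borel_sigma_additive_def)
qed

text \<open>
  The terms \<open>x i\<close> may have both signs, and \<open>ennreal\<close> truncates the negative ones to zero; this only
  increases the partial sums.
\<close>

lemma ennreal_suminf_ge:
  fixes x :: "nat \<Rightarrow> real" and p :: "nat \<Rightarrow> ennreal"
  assumes "x sums s" and "\<And>i. ennreal (x i) \<le> p i"
  shows "ennreal s \<le> (\<Sum>i. p i)"
proof (rule LIMSEQ_le_const2)
  show "(\<lambda>n. ennreal (\<Sum>i<n. x i)) \<longlonglongrightarrow> ennreal s"
    using assms(1) by (simp add: sums_def tendsto_ennrealI)
  have "ennreal (\<Sum>i<n. x i) \<le> (\<Sum>i<n. p i)" for n
  proof (induction n)
    case (Suc n)
    have "ennreal ((\<Sum>i<n. x i) + x n) \<le> ennreal (max 0 (\<Sum>i<n. x i) + max 0 (x n))"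
      by (intro ennreal_leI) auto
    also have "\<dots> = ennreal (\<Sum>i<n. x i) + ennreal (x n)"
      by (simp add: max_def ennreal_neg)
    also have "\<dots> \<le> (\<Sum>i<n. p i) + p n"
      by (intro add_mono Suc.IH assms)
    finally show ?case by simp
  qed simp
  then show "\<exists>N. \<forall>n\<ge>N. ennreal (\<Sum>i<n. x i) \<le> (\<Sum>i. p i)"
    by (meson order_trans sum_le_suminf zero_le finite_lessThan summableI)
qed

context
  fixes \<sigma> :: "'a::topological_space set \<Rightarrow> real" and C :: real
  assumes sigma_additive: "borel_sigma_additive \<sigma>"
    and bounded: "\<And>A. A \<in> sets borel \<Longrightarrow> \<sigma> A \<le> C"
begin

text \<open>
  The supremum is superadditive on disjoint sets because competitors can be united, one with a
  nonpositive value being replaced by the empty set. It is countably subadditive because a competitor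
  for the union is cut into competitors for the pieces.
\<close>

lemma emeasure_positive_part:
  assumes "A \<in> sets borel"
  shows "emeasure (positive_part \<sigma>) A = (SUP B \<in> {B \<in> sets borel. B \<subseteq> A}. ennreal (\<sigma> B))"
proof -
  let ?p = "\<lambda>A. SUP B \<in> {B \<in> sets borel. B \<subseteq> A}. ennreal (\<sigma> B)"
  note empty = borel_sigma_additive_empty[OF sigma_additive]
  have upper: "ennreal (\<sigma> B) \<le> ?p A" if "B \<in> sets borel" "B \<subseteq> A" for A B
    using that by (intro SUP_upper) auto
  have mono: "?p A \<le> ?p B" if "A \<subseteq> B" for A B
    using that by (intro SUP_subset_mono) auto
  have binary: "?p A + ?p B \<le> ?p (A \<union> B)"
    if "A \<in> sets borel" "B \<in> sets borel" "A \<inter> B = {}" for A B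
  proof -
    have "ennreal (\<sigma> A') + ennreal (\<sigma> B') \<le> ?p (A \<union> B)"
      if A': "A' \<in> sets borel" "A' \<subseteq> A" and B': "B' \<in> sets borel" "B' \<subseteq> B" for A' B'
    proof -
      consider "\<sigma> A' \<le> 0" | "\<sigma> B' \<le> 0" | "\<sigma> A' > 0" "\<sigma> B' > 0"
        by linarith
      then show ?thesis
      proof cases
        case 1
        then have "ennreal (\<sigma> A') = 0" by (rule ennreal_neg)
        then show ?thesis using B' by (auto intro!: upper)
      next
        case 2
        then have "ennreal (\<sigma> B') = 0" by (rule ennreal_neg)
        then show ?thesis using A' by (auto intro!: upper)
      next
        case 3
        have "\<sigma> (A' \<union> B') = \<sigma> A' + \<sigma> B'"
          using A' B' \<open>A \<inter> B = {}\<close> by (intro borel_sigma_additive_Un[OF sigma_additive]) auto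
        then have "ennreal (\<sigma> A') + ennreal (\<sigma> B') = ennreal (\<sigma> (A' \<union> B'))"
          using 3 by simp
        also have "\<dots> \<le> ?p (A \<union> B)"
          using A' B' by (intro upper) auto
        finally show ?thesis .
      qed
    qed
    moreover have ne: "{B' \<in> sets borel. B' \<subseteq> D} \<noteq> {}" for D :: "'a set"
      by auto
    ultimately show ?thesis
      by (subst ennreal_SUP_add_left[symmetric, OF ne], intro SUP_least,
          subst ennreal_SUP_add_right[OF ne], intro SUP_least) auto
  qed
  have "positive (sets borel) ?p"
    using empty by (auto simp: positive_def)
  moreover have "countably_additive (sets borel) ?p"
  proof (rule countably_additiveI)
    fix E :: "nat \<Rightarrow> 'a set"
    assume E: "range E \<subseteq> sets borel" "disjoint_family E" "(\<Union>i. E i) \<in> sets borel"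
    have "(\<Sum>i<n. ?p (E i)) \<le> ?p (\<Union>i<n. E i)" for n
    proof (induction n)
      case (Suc n)
      have "(\<Sum>i<Suc n. ?p (E i)) \<le> ?p (\<Union>i<n. E i) + ?p (E n)"
        using Suc by (simp add: add_right_mono)
      also have "\<dots> \<le> ?p ((\<Union>i<n. E i) \<union> E n)"
      proof (rule binary)
        have "E i \<inter> E n = {}" if "i < n" for i
          using that by (intro disjoint_family_onD[OF E(2)]) auto
        then show "(\<Union>i<n. E i) \<inter> E n = {}" by blast
      qed (use E(1) in auto)
      also have "(\<Union>i<n. E i) \<union> E n = (\<Union>i<Suc n. E i)"
        by (auto simp: less_Suc_eq)
      finally show ?case .
    qed (simp add: empty)
    then have "(\<Sum>i<n. ?p (E i)) \<le> ?p (\<Union>i. E i)" for n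
      by (rule order_trans) (auto intro!: mono)
    then have "(\<Sum>i. ?p (E i)) \<le> ?p (\<Union>i. E i)"
      by (intro suminf_le_const summableI) auto
    moreover have "?p (\<Union>i. E i) \<le> (\<Sum>i. ?p (E i))"
    proof (rule SUP_least)
      fix B assume "B \<in> {B \<in> sets borel. B \<subseteq> (\<Union>i. E i)}"
      then have B: "B \<in> sets borel" "(\<Union>i. B \<inter> E i) = B"
        by auto
      have "(\<lambda>i. \<sigma> (B \<inter> E i)) sums \<sigma> (\<Union>i. B \<inter> E i)"
        using E B(1) by (intro borel_sigma_additiveD[OF sigma_additive]) (auto simp: disjoint_family_on_def)
      then show "ennreal (\<sigma> B) \<le> (\<Sum>i. ?p (E i))"
        unfolding B using E B by (elim ennreal_suminf_ge) (auto intro!: upper)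
    qed
    ultimately show "(\<Sum>i. ?p (E i)) = ?p (\<Union>i. E i)"
      by (rule antisym)
  qed
  ultimately show ?thesis
    unfolding positive_part_def using assms sets.sigma_algebra_axioms[of borel]
    by (intro emeasure_measure_of_sigma) auto
qed

lemma sets_positive_part [simp]: "sets (positive_part \<sigma>) = sets borel"
  and space_positive_part [simp]: "space (positive_part \<sigma>) = UNIV"
  using sets.sigma_sets_eq[of borel] by (simp_all add: positive_part_def)

lemma finite_measure_positive_part: "finite_measure (positive_part \<sigma>)"
proof
  have "emeasure (positive_part \<sigma>) UNIV \<le> ennreal C"
    by (subst emeasure_positive_part) (auto intro!: SUP_least ennreal_leI bounded)
  then show "emeasure (positive_part \<sigma>) (space (positive_part \<sigma>)) \<noteq> \<infinity>"
    by (auto simp: top_unique)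
qed

lemma measure_positive_part_ge:
  assumes "A \<in> sets borel" "B \<in> sets borel" "B \<subseteq> A"
  shows "\<sigma> B \<le> measure (positive_part \<sigma>) A"
proof -
  interpret finite_measure "positive_part \<sigma>"
    by (rule finite_measure_positive_part)
  have "ennreal (\<sigma> B) \<le> emeasure (positive_part \<sigma>) A"
    using assms by (subst emeasure_positive_part) (auto intro!: SUP_upper)
  then show ?thesis
    by (simp add: emeasure_eq_measure ennreal_le_iff)
qed

lemma measure_positive_part_le:
  assumes "A \<in> sets borel" "\<And>B. B \<in> sets borel \<Longrightarrow> B \<subseteq> A \<Longrightarrow> \<sigma> B \<le> c"
  shows "measure (positive_part \<sigma>) A \<le> c"
proof -
  interpret finite_measure "positive_part \<sigma>"
    by (rule finite_measure_positive_part)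
  have "0 \<le> c"
    using assms(2)[of "{}"] borel_sigma_additive_empty[OF sigma_additive] by simp
  have "emeasure (positive_part \<sigma>) A \<le> ennreal c"
    using assms by (subst emeasure_positive_part) (auto intro!: SUP_least ennreal_leI)
  then show ?thesis
    using \<open>0 \<le> c\<close> by (simp add: emeasure_eq_measure ennreal_le_iff)
qed

end

text \<open>
  Passing from \<open>B \<subseteq> A\<close> to \<open>A - B\<close> turns \<open>\<sigma> B\<close> into \<open>\<sigma> A + (- \<sigma>) (A - B)\<close>, so the suprema that define the
  two parts on \<open>A\<close> differ by \<open>\<sigma> A\<close>.
\<close>

lemma Jordan_decomposition:
  fixes \<sigma> :: "'a::topological_space set \<Rightarrow> real"
  assumes add: "borel_sigma_additive \<sigma>" and bd: "\<And>A. A \<in> sets borel \<Longrightarrow> \<bar>\<sigma> A\<bar> \<le> C"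
  obtains P N where "finite_measure P" "finite_measure N"
    "sets P = sets borel" "sets N = sets borel"
    "\<And>A. A \<in> sets borel \<Longrightarrow> \<sigma> A = measure P A - measure N A"
    "\<And>f. signed_integral \<sigma> f = integral\<^sup>L P f - integral\<^sup>L N f"
proof -
  let ?P = "positive_part \<sigma>" and ?N = "positive_part (\<lambda>A. - \<sigma> A)"
  have addN: "borel_sigma_additive (\<lambda>A. - \<sigma> A)"
    using borel_sigma_additive_bounded_linear[OF bounded_linear_minus[OF bounded_linear_ident] add] .
  have bdP: "\<sigma> A \<le> C" and bdN: "- \<sigma> A \<le> C" if "A \<in> sets borel" for A
    using bd[OF that] by auto
  have "\<sigma> A = measure ?P A - measure ?N A" if A: "A \<in> sets borel" for A
  proof (rule antisym)
    have "measure ?N A \<le> measure ?P A - \<sigma> A"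
    proof (rule measure_positive_part_le[OF addN bdN A])
      fix B assume B: "B \<in> sets borel" "B \<subseteq> A"
      show "- \<sigma> B \<le> measure ?P A - \<sigma> A"
        using measure_positive_part_ge[OF add bdP A, of "A - B"] A B
          borel_sigma_additive_Diff[OF add A B] by auto
    qed
    then show "\<sigma> A \<le> measure ?P A - measure ?N A" by simp
    have "measure ?P A \<le> measure ?N A + \<sigma> A"
    proof (rule measure_positive_part_le[OF add bdP A])
      fix B assume B: "B \<in> sets borel" "B \<subseteq> A"
      show "\<sigma> B \<le> measure ?N A + \<sigma> A"
        using measure_positive_part_ge[OF addN bdN A, of "A - B"] A B
          borel_sigma_additive_Diff[OF add A B] by auto
    qed
    then show "measure ?P A - measure ?N A \<le> \<sigma> A" by simp
  qed
  then show thesis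
    by (intro that[of ?P ?N])
       (auto simp: signed_integral_def sets_positive_part[OF add bdP] sets_positive_part[OF addN bdN]
             intro: finite_measure_positive_part[OF add bdP] finite_measure_positive_part[OF addN bdN])
qed

definition complex_measure :: "('a::topological_space set \<Rightarrow> complex) \<Rightarrow> bool"
  where "complex_measure \<mu> \<longleftrightarrow> borel_sigma_additive \<mu> \<and> variation \<mu> UNIV < \<infinity>"

lemma complex_radon_measure_imp_complex_measure:
  "\<mu> \<in> complex_radon_measures \<Longrightarrow> complex_measure \<mu>"
  by (auto simp: complex_measure_def complex_radon_measures_def borel_sigma_additive_def)

lemma sum_norm_le_tv_norm:
  fixes \<mu> :: "'a::topological_space set \<Rightarrow> complex"
  assumes \<mu>: "complex_measure \<mu>" and I: "finite I"
    and E: "\<And>i. i \<in> I \<Longrightarrow> E i \<in> sets borel" "disjoint_family_on E I" "(\<Union>i\<in>I. E i) = UNIV"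
  shows "(\<Sum>i\<in>I. norm (\<mu> (E i))) \<le> tv_norm \<mu>"
proof -
  \<comment> \<open>Empty members are discarded because a partition has nonempty members; on the remaining
    indices, disjointness makes \<open>E\<close> injective.\<close>
  define J where "J = {i \<in> I. E i \<noteq> {}}"
  have J: "finite J" "J \<subseteq> I"
    using I by (auto simp: J_def)
  have empty: "\<mu> {} = 0"
    using \<mu> by (auto simp: complex_measure_def intro: borel_sigma_additive_empty)
  have inj: "inj_on E J"
    using E(2) by (auto simp: inj_on_def J_def disjoint_family_on_def)
  have "E i \<inter> E j = {}" if "i \<in> J" "j \<in> J" "E i \<noteq> E j" for i j
    using that J(2) by (intro disjoint_family_onD[OF E(2)]) blast+
  moreover have "(\<Union>i\<in>J. E i) = UNIV"
    unfolding E(3)[symmetric] J_def by blast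
  moreover have "{} \<notin> E ` J"
    by (auto simp: J_def)
  ultimately have "partition_on UNIV (E ` J)"
    unfolding partition_on_def disjoint_def by blast
  then have "(\<Sum>F\<in>E ` J. ennreal (norm (\<mu> F))) \<le> variation \<mu> UNIV"
    unfolding variation_def using J E by (intro SUP_upper) auto
  then have "ennreal (\<Sum>i\<in>J. norm (\<mu> (E i))) \<le> variation \<mu> UNIV"
    by (simp add: sum.reindex[OF inj] sum_ennreal)
  then have "(\<Sum>i\<in>J. norm (\<mu> (E i))) \<le> tv_norm \<mu>"
    using \<mu> unfolding tv_norm_def complex_measure_def
    by (metis enn2real_ennreal enn2real_mono infinity_ennreal_def sum_nonneg norm_ge_zero)
  also have "(\<Sum>i\<in>J. norm (\<mu> (E i))) = (\<Sum>i\<in>I. norm (\<mu> (E i)))"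
    using I by (intro sum.mono_neutral_left) (auto simp: J_def empty)
  finally show ?thesis .
qed

lemma norm_le_tv_norm:
  assumes "complex_measure \<mu>" "A \<in> sets borel"
  shows "norm (\<mu> A) \<le> tv_norm \<mu>"
proof -
  have "(\<Sum>i\<in>(UNIV::bool set). norm (\<mu> (if i then A else - A))) \<le> tv_norm \<mu>"
    using assms by (intro sum_norm_le_tv_norm) (auto simp: disjoint_family_on_def UNIV_bool)
  then have "norm (\<mu> A) + norm (\<mu> (- A)) \<le> tv_norm \<mu>"
    by (simp add: UNIV_bool add.commute)
  then show ?thesis
    using norm_ge_zero[of "\<mu> (- A)"] by linarith
qed

lemma complex_integral_Jordan:
  fixes \<mu> :: "'a::topological_space set \<Rightarrow> complex"
  assumes "complex_measure \<mu>"
  obtains P N Q R where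
    "finite_measure P" "finite_measure N" "finite_measure Q" "finite_measure R"
    "sets P = sets borel" "sets N = sets borel" "sets Q = sets borel" "sets R = sets borel"
    "\<And>A. A \<in> sets borel \<Longrightarrow>
       \<mu> A = of_real (measure P A - measure N A) + \<i> * of_real (measure Q A - measure R A)"
    "\<And>f. complex_integral \<mu> f =
       (integral\<^sup>L P f - integral\<^sup>L N f) + \<i> * (integral\<^sup>L Q f - integral\<^sup>L R f)"
proof -
  have add: "borel_sigma_additive \<mu>"
    using assms by (simp add: complex_measure_def)
  note addR = borel_sigma_additive_bounded_linear[OF bounded_linear_Re add]
  note addI = borel_sigma_additive_bounded_linear[OF bounded_linear_Im add]
  have bdR: "\<bar>Re (\<mu> A)\<bar> \<le> tv_norm \<mu>" and bdI: "\<bar>Im (\<mu> A)\<bar> \<le> tv_norm \<mu>" if "A \<in> sets borel" for A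
    using norm_le_tv_norm[OF assms that] abs_Re_le_cmod[of "\<mu> A"] abs_Im_le_cmod[of "\<mu> A"] by auto
  obtain P N where PN: "finite_measure P" "finite_measure N" "sets P = sets borel" "sets N = sets borel"
    "\<And>A. A \<in> sets borel \<Longrightarrow> Re (\<mu> A) = measure P A - measure N A"
    "\<And>f. signed_integral (\<lambda>A. Re (\<mu> A)) f = integral\<^sup>L P f - integral\<^sup>L N f"
    using Jordan_decomposition[OF addR bdR] by metis
  obtain Q R where QR: "finite_measure Q" "finite_measure R" "sets Q = sets borel" "sets R = sets borel"
    "\<And>A. A \<in> sets borel \<Longrightarrow> Im (\<mu> A) = measure Q A - measure R A"
    "\<And>f. signed_integral (\<lambda>A. Im (\<mu> A)) f = integral\<^sup>L Q f - integral\<^sup>L R f"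
    using Jordan_decomposition[OF addI bdI] by metis
  show thesis
    using PN QR by (intro that[of P N Q R]) (auto simp: complex_integral_def complex_eq_iff)
qed

section \<open>Integration against a complex measure\<close>

definition bounded_borel :: "('a::topological_space \<Rightarrow> complex) \<Rightarrow> bool"
  where "bounded_borel f \<longleftrightarrow> f \<in> borel_measurable borel \<and> (\<exists>B. \<forall>x. norm (f x) \<le> B)"

lemma bounded_borelI:
  "f \<in> borel_measurable borel \<Longrightarrow> (\<And>x. norm (f x) \<le> B) \<Longrightarrow> bounded_borel f"
  by (auto simp: bounded_borel_def)

lemma bounded_borel_indicator: "A \<in> sets borel \<Longrightarrow> bounded_borel (indicator A)"
  by (intro bounded_borelI[where B=1]) (auto simp: indicator_def)

lemma bounded_borel_const: "bounded_borel (\<lambda>x. c)"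
  by (intro bounded_borelI[where B="norm c"]) auto

lemma bounded_borel_add:
  assumes "bounded_borel f" "bounded_borel g"
  shows "bounded_borel (\<lambda>x. f x + g x)"
proof -
  obtain B C where "\<And>x. norm (f x) \<le> B" "\<And>x. norm (g x) \<le> C"
    using assms by (auto simp: bounded_borel_def)
  then show ?thesis
    using assms by (intro bounded_borelI[where B="B + C"])
      (auto simp: bounded_borel_def intro: norm_triangle_le add_mono)
qed

lemma bounded_borel_mult:
  assumes "bounded_borel f" "bounded_borel g"
  shows "bounded_borel (\<lambda>x. f x * g x)"
proof -
  obtain B C where BC: "\<And>x. norm (f x) \<le> B" "\<And>x. norm (g x) \<le> C"
    using assms by (auto simp: bounded_borel_def)
  have "norm (f x * g x) \<le> B * C" for x
    unfolding norm_mult by (intro mult_mono BC order_trans[OF norm_ge_zero BC(1)[of x]]) auto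
  then show ?thesis
    using assms by (intro bounded_borelI[where B="B * C"]) (auto simp: bounded_borel_def)
qed

lemma bounded_borel_sum:
  "finite I \<Longrightarrow> (\<And>i. i \<in> I \<Longrightarrow> bounded_borel (f i)) \<Longrightarrow> bounded_borel (\<lambda>x. \<Sum>i\<in>I. f i x)"
  by (induction I rule: finite_induct) (auto intro: bounded_borel_add bounded_borel_const)

lemma integrable_bounded_borel:
  assumes "finite_measure M" "sets M = sets borel" "bounded_borel f"
  shows "integrable M f"
proof -
  obtain B where "\<And>x. norm (f x) \<le> B"
    using assms by (auto simp: bounded_borel_def)
  then show ?thesis
    using assms by (intro finite_measure.integrable_const_bound[where B=B])
      (auto simp: bounded_borel_def measurable_cong_sets[OF assms(2) refl])
qed

text \<open>
  Every integral below, and every finite combination of integrals, is such a functional. This makes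
  it possible to verify identities between integrals on indicators only.
\<close>

definition bounded_functional :: "(('a::topological_space \<Rightarrow> complex) \<Rightarrow> complex) \<Rightarrow> bool"
  where "bounded_functional \<Phi> \<longleftrightarrow>
    (\<forall>f g. bounded_borel f \<longrightarrow> bounded_borel g \<longrightarrow> \<Phi> (\<lambda>x. f x + g x) = \<Phi> f + \<Phi> g) \<and>
    (\<forall>c f. bounded_borel f \<longrightarrow> \<Phi> (\<lambda>x. c * f x) = c * \<Phi> f) \<and>
    (\<exists>C. \<forall>f B. bounded_borel f \<longrightarrow> (\<forall>x. norm (f x) \<le> B) \<longrightarrow> norm (\<Phi> f) \<le> C * B)"

lemma bounded_functional_bound:
  assumes "bounded_functional \<Phi>"
  obtains C where
    "\<And>f B. bounded_borel f \<Longrightarrow> (\<And>x. norm (f x) \<le> B) \<Longrightarrow> norm (\<Phi> f) \<le> C * B"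
proof -
  have "\<exists>C. \<forall>f B. bounded_borel f \<longrightarrow> (\<forall>x. norm (f x) \<le> B) \<longrightarrow> norm (\<Phi> f) \<le> C * B"
    using assms by (simp add: bounded_functional_def)
  then show thesis
    using that by blast
qed

lemma bounded_functional_add:
  "bounded_functional \<Phi> \<Longrightarrow> bounded_borel f \<Longrightarrow> bounded_borel g \<Longrightarrow>
    \<Phi> (\<lambda>x. f x + g x) = \<Phi> f + \<Phi> g"
  by (simp add: bounded_functional_def)

lemma bounded_functional_scale:
  "bounded_functional \<Phi> \<Longrightarrow> bounded_borel f \<Longrightarrow> \<Phi> (\<lambda>x. c * f x) = c * \<Phi> f"
  by (simp add: bounded_functional_def)

lemma bounded_functional_diff:
  assumes "bounded_functional \<Phi>" "bounded_borel f" "bounded_borel g"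
  shows "\<Phi> (\<lambda>x. f x - g x) = \<Phi> f - \<Phi> g"
  using bounded_functional_add[OF assms(1,2), of "\<lambda>x. - 1 * g x"]
    bounded_functional_scale[OF assms(1,3), of "- 1"]
    bounded_borel_mult[OF bounded_borel_const[of "-1"] assms(3)] by simp

lemma bounded_functional_sum:
  assumes \<Phi>: "bounded_functional \<Phi>" and I: "finite I" and f: "\<And>i. i \<in> I \<Longrightarrow> bounded_borel (f i)"
  shows "\<Phi> (\<lambda>x. \<Sum>i\<in>I. c i * f i x) = (\<Sum>i\<in>I. c i * \<Phi> (f i))"
  using I f
proof (induction I rule: finite_induct)
  case empty
  then show ?case
    using bounded_functional_scale[OF \<Phi> bounded_borel_const[of 0], of 0] by simp
next
  case (insert i I)
  have "bounded_borel (\<lambda>x. \<Sum>i\<in>I. c i * f i x)"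
    using insert by (intro bounded_borel_sum bounded_borel_mult bounded_borel_const) auto
  then show ?case
    using insert by (simp add: bounded_functional_add[OF \<Phi>] bounded_functional_scale[OF \<Phi>]
        bounded_borel_mult[OF bounded_borel_const])
qed

text \<open>
  Real and imaginary part are rounded down to multiples of \<open>\<epsilon> / 2\<close>; boundedness of \<open>f\<close> leaves finitely
  many values. Uniform closeness, as opposed to pointwise convergence, is what makes supremum-norm
  continuity of a functional applicable.
\<close>

lemma uniform_simple_approximation:
  fixes f :: "'a::topological_space \<Rightarrow> complex"
  assumes f: "bounded_borel f" and e: "\<epsilon> > 0"
  obtains s where "finite (range s)" "bounded_borel s" "\<And>x. norm (f x - s x) \<le> \<epsilon>"
proof -
  define \<delta> where "\<delta> = \<epsilon> / 2"
  have \<delta>: "\<delta> > 0" using e by (simp add: \<delta>_def)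
  define s where "s x = Complex (\<delta> * \<lfloor>Re (f x) / \<delta>\<rfloor>) (\<delta> * \<lfloor>Im (f x) / \<delta>\<rfloor>)" for x
  obtain B where B: "\<And>x. norm (f x) \<le> B"
    using f by (auto simp: bounded_borel_def)
  have round: "\<bar>t - \<delta> * \<lfloor>t / \<delta>\<rfloor>\<bar> \<le> \<delta>" for t
  proof -
    have "t - \<delta> * \<lfloor>t / \<delta>\<rfloor> = \<delta> * (t / \<delta> - \<lfloor>t / \<delta>\<rfloor>)"
      using \<delta> by (simp add: field_simps)
    moreover have "\<bar>t / \<delta> - \<lfloor>t / \<delta>\<rfloor>\<bar> \<le> 1"
      by linarith
    ultimately show ?thesis
      using \<delta> by (simp add: abs_mult)
  qed
  have near: "norm (f x - s x) \<le> \<epsilon>" for x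
    using cmod_le[of "f x - s x"] round[of "Re (f x)"] round[of "Im (f x)"]
    by (simp add: s_def \<delta>_def)
  let ?Z = "(\<lambda>k::int. \<delta> * k) ` {\<lfloor>- B / \<delta>\<rfloor>..\<lfloor>B / \<delta>\<rfloor>}"
  have Z: "\<delta> * \<lfloor>t / \<delta>\<rfloor> \<in> ?Z" if "\<bar>t\<bar> \<le> B" for t
  proof -
    have "- B / \<delta> \<le> t / \<delta>" "t / \<delta> \<le> B / \<delta>"
      using that \<delta> by (intro divide_right_mono; simp add: abs_le_iff)+
    then have "\<lfloor>t / \<delta>\<rfloor> \<in> {\<lfloor>- B / \<delta>\<rfloor>..\<lfloor>B / \<delta>\<rfloor>}"
      unfolding atLeastAtMost_iff by (intro conjI floor_mono)
    then show ?thesis by (rule imageI)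
  qed
  have "s x \<in> (\<lambda>(u, v). Complex u v) ` (?Z \<times> ?Z)" for x
    unfolding s_def
    by (rule image_eqI[where x="(\<delta> * \<lfloor>Re (f x) / \<delta>\<rfloor>, \<delta> * \<lfloor>Im (f x) / \<delta>\<rfloor>)"], simp,
        intro SigmaI Z order_trans[OF abs_Re_le_cmod B] order_trans[OF abs_Im_le_cmod B])
  then have "range s \<subseteq> (\<lambda>(u, v). Complex u v) ` (?Z \<times> ?Z)"
    by blast
  then have fin: "finite (range s)"
    by (rule finite_subset) simp
  have "s \<in> borel_measurable borel"
  proof -
    have [measurable]: "f \<in> borel_measurable borel"
      using f by (simp add: bounded_borel_def)
    show ?thesis
      unfolding s_def Complex_eq by measurable
  qed
  moreover have "norm (s x) \<le> B + \<epsilon>" for x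
    using norm_triangle_sub[of "s x" "f x"] near[of x] B[of x] by (simp add: norm_minus_commute)
  ultimately show thesis
    using fin near by (intro that[of s]) (auto intro: bounded_borelI)
qed

lemma simple_function_eq_sum:
  fixes s :: "'a \<Rightarrow> complex"
  assumes "finite (range s)"
  shows "s = (\<lambda>x. \<Sum>c\<in>range s. c * indicator (s -` {c}) x)"
proof
  fix x
  have "(\<Sum>c\<in>range s. c * indicator (s -` {c}) x) = (\<Sum>c\<in>range s. if c = s x then c else 0)"
    by (intro sum.cong) (auto simp: indicator_def)
  also have "\<dots> = s x"
    using assms by simp
  finally show "s x = (\<Sum>c\<in>range s. c * indicator (s -` {c}) x)" by simp
qed

lemma bounded_functional_simple:
  assumes \<Phi>: "bounded_functional \<Phi>" and s: "finite (range s)" "bounded_borel s"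
  shows "\<Phi> s = (\<Sum>c\<in>range s. c * \<Phi> (indicator (s -` {c})))"
proof -
  have "s -` {c} \<in> sets borel" for c
    using s measurable_sets[of s borel borel "{c}"] by (auto simp: bounded_borel_def)
  then show ?thesis
    using s by (subst simple_function_eq_sum[OF s(1)])
      (intro bounded_functional_sum[OF \<Phi>] bounded_borel_indicator)
qed

lemma bounded_functional_eqI:
  fixes f :: "'a::topological_space \<Rightarrow> complex"
  assumes \<Phi>: "bounded_functional \<Phi>" and \<Psi>: "bounded_functional \<Psi>"
    and eq: "\<And>A. A \<in> sets borel \<Longrightarrow> \<Phi> (indicator A) = \<Psi> (indicator A)"
    and f: "bounded_borel f"
  shows "\<Phi> f = \<Psi> f"
proof -
  obtain C where C: "\<And>f B. bounded_borel f \<Longrightarrow> (\<And>x. norm (f x) \<le> B) \<Longrightarrow> norm (\<Phi> f) \<le> C * B"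
    using bounded_functional_bound[OF \<Phi>] by blast
  obtain D where D: "\<And>f B. bounded_borel f \<Longrightarrow> (\<And>x. norm (f x) \<le> B) \<Longrightarrow> norm (\<Psi> f) \<le> D * B"
    using bounded_functional_bound[OF \<Psi>] by blast
  have "norm (\<Phi> f - \<Psi> f) \<le> (C + D) * \<epsilon>" if \<epsilon>: "\<epsilon> > 0" for \<epsilon>
  proof -
    obtain s where s: "finite (range s)" "bounded_borel s" and near: "\<And>x. norm (f x - s x) \<le> \<epsilon>"
      using uniform_simple_approximation[OF f \<epsilon>] by blast
    have "s -` {c} \<in> sets borel" for c
      using s measurable_sets[of s borel borel "{c}"] by (auto simp: bounded_borel_def)
    then have "\<Phi> s = \<Psi> s"
      by (simp add: bounded_functional_simple[OF \<Phi> s] bounded_functional_simple[OF \<Psi> s] eq)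
    moreover have fs: "bounded_borel (\<lambda>x. f x - s x)"
      using bounded_borel_add[OF f bounded_borel_mult[OF bounded_borel_const[of "-1"] s(2)]] by simp
    ultimately have "\<Phi> f - \<Psi> f = \<Phi> (\<lambda>x. f x - s x) - \<Psi> (\<lambda>x. f x - s x)"
      using f s by (simp add: bounded_functional_diff[OF \<Phi>] bounded_functional_diff[OF \<Psi>])
    then have "norm (\<Phi> f - \<Psi> f) \<le> norm (\<Phi> (\<lambda>x. f x - s x)) + norm (\<Psi> (\<lambda>x. f x - s x))"
      by (metis norm_triangle_ineq4)
    also have "\<dots> \<le> C * \<epsilon> + D * \<epsilon>"
      by (intro add_mono C[OF fs near] D[OF fs near])
    finally show ?thesis by (simp add: algebra_simps)
  qed
  then have "\<forall>\<^sub>F \<epsilon> in at_right 0. norm (\<Phi> f - \<Psi> f) \<le> (C + D) * \<epsilon>"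
    by (auto simp: eventually_at_right_less intro: eventually_mono[OF eventually_at_right_less])
  moreover have "((\<lambda>\<epsilon>. (C + D) * \<epsilon>) \<longlongrightarrow> (C + D) * 0) (at_right 0)"
    by (intro tendsto_intros)
  ultimately have "norm (\<Phi> f - \<Psi> f) \<le> (C + D) * 0"
    by (intro tendsto_lowerbound[where F="at_right (0::real)"]) auto
  then show ?thesis by simp
qed

lemma bounded_functional_integral:
  assumes M: "finite_measure M" "sets M = sets (borel :: 'a::topological_space measure)"
  shows "bounded_functional (\<lambda>f :: 'a \<Rightarrow> complex. integral\<^sup>L M f)"
proof -
  have "norm (integral\<^sup>L M f) \<le> measure M UNIV * B"
    if "bounded_borel f" "\<forall>x. norm (f x) \<le> B" for f B
  proof -
    interpret finite_measure M by fact
    have "norm (integral\<^sup>L M f) \<le> (\<integral>x. norm (f x) \<partial>M)"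
      by (rule integral_norm_bound)
    also have "\<dots> \<le> (\<integral>x. B \<partial>M)"
      using that M by (intro integral_mono integrable_norm integrable_bounded_borel) auto
    also have "\<dots> = measure M UNIV * B"
      using sets_eq_imp_space_eq[OF M(2)] by simp
    finally show ?thesis .
  qed
  then show ?thesis
    using integrable_bounded_borel[OF M] by (auto simp: bounded_functional_def)
qed

lemma bounded_functional_lincomb:
  assumes "bounded_functional \<Phi>" "bounded_functional \<Psi>"
  shows "bounded_functional (\<lambda>f. a * \<Phi> f + b * \<Psi> f)"
proof -
  obtain C where C: "\<And>f B. bounded_borel f \<Longrightarrow> (\<And>x. norm (f x) \<le> B) \<Longrightarrow> norm (\<Phi> f) \<le> C * B"
    using bounded_functional_bound[OF assms(1)] by blast
  obtain D where D: "\<And>f B. bounded_borel f \<Longrightarrow> (\<And>x. norm (f x) \<le> B) \<Longrightarrow> norm (\<Psi> f) \<le> D * B"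
    using bounded_functional_bound[OF assms(2)] by blast
  have "norm (a * \<Phi> f + b * \<Psi> f) \<le> (norm a * C + norm b * D) * B"
    if "bounded_borel f" "\<forall>x. norm (f x) \<le> B" for f B
  proof -
    have "norm (a * \<Phi> f + b * \<Psi> f) \<le> norm a * norm (\<Phi> f) + norm b * norm (\<Psi> f)"
      by (metis norm_triangle_ineq norm_mult)
    also have "\<dots> \<le> norm a * (C * B) + norm b * (D * B)"
      using that by (intro add_mono mult_left_mono C[OF that(1)] D[OF that(1)]) auto
    finally show ?thesis by (simp add: algebra_simps)
  qed
  then show ?thesis
    unfolding bounded_functional_def
    by (intro conjI allI impI exI[of _ "norm a * C + norm b * D"])
       (simp_all add: bounded_functional_add[OF assms(1)] bounded_functional_add[OF assms(2)]
         bounded_functional_scale[OF assms(1)] bounded_functional_scale[OF assms(2)] algebra_simps)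
qed

lemma bounded_functional_mult:
  assumes "bounded_functional \<Phi>" "bounded_borel g"
  shows "bounded_functional (\<lambda>f. \<Phi> (\<lambda>x. f x * g x))"
proof -
  obtain C where C: "\<And>f B. bounded_borel f \<Longrightarrow> (\<And>x. norm (f x) \<le> B) \<Longrightarrow> norm (\<Phi> f) \<le> C * B"
    using bounded_functional_bound[OF assms(1)] by blast
  obtain D where D: "\<And>x. norm (g x) \<le> D"
    using assms by (auto simp: bounded_borel_def)
  have "norm (\<Phi> (\<lambda>x. f x * g x)) \<le> (C * D) * B"
    if f: "bounded_borel f" "\<forall>x. norm (f x) \<le> B" for f B
  proof -
    have "norm (f x * g x) \<le> B * D" for x
      unfolding norm_mult using f(2) by (intro mult_mono D order_trans[OF norm_ge_zero]) auto
    from C[OF bounded_borel_mult[OF f(1) assms(2)] this] show ?thesis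
      by (simp add: mult_ac)
  qed
  then show ?thesis
    unfolding bounded_functional_def
    by (intro conjI allI impI exI[of _ "C * D"])
       (simp_all add: distrib_right mult.assoc bounded_functional_add[OF assms(1)]
         bounded_functional_scale[OF assms(1)] bounded_borel_mult[OF _ assms(2)])
qed

lemma complex_integral_indicator:
  assumes "complex_measure \<mu>" "A \<in> sets borel"
  shows "complex_integral \<mu> (indicator A) = \<mu> A"
proof -
  obtain P N Q R where *: "finite_measure P" "finite_measure N" "finite_measure Q" "finite_measure R"
    "sets P = sets borel" "sets N = sets borel" "sets Q = sets borel" "sets R = sets borel"
    "\<And>A. A \<in> sets borel \<Longrightarrow>
       \<mu> A = of_real (measure P A - measure N A) + \<i> * of_real (measure Q A - measure R A)"
    "\<And>f. complex_integral \<mu> f =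
       (integral\<^sup>L P f - integral\<^sup>L N f) + \<i> * (integral\<^sup>L Q f - integral\<^sup>L R f)"
    using complex_integral_Jordan[OF assms(1)] by metis
  have "integral\<^sup>L M (indicator A :: 'a \<Rightarrow> complex) = of_real (measure M A)"
    if "finite_measure M" "sets M = sets borel" for M :: "'a measure"
    using integral_complex_of_real[of M "indicator A"] sets_eq_imp_space_eq[OF that(2)]
    by (simp add: of_real_indicator)
  then show ?thesis
    using * assms(2) by simp
qed

lemma borel_sigma_additive_integral:
  assumes M: "finite_measure M" "sets M = sets (borel :: 'a::topological_space measure)"
    and g: "bounded_borel g"
  shows "borel_sigma_additive (\<lambda>A. \<integral>x. indicator A x * g x \<partial>M)"
  unfolding borel_sigma_additive_def
proof (intro allI impI)
  fix E :: "nat \<Rightarrow> 'a set"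
  assume E: "range E \<subseteq> sets borel" and disj: "disjoint_family E"
  obtain B where B: "\<And>x. norm (g x) \<le> B"
    using g by (auto simp: bounded_borel_def)
  interpret finite_measure M by fact
  have bb: "bounded_borel (\<lambda>x. indicator A x * g x)" if "A \<in> sets borel" for A
    using that g by (intro bounded_borel_mult bounded_borel_indicator)
  have "(\<lambda>n. \<integral>x. indicator (\<Union>i<n. E i) x * g x \<partial>M) \<longlonglongrightarrow> (\<integral>x. indicator (\<Union>i. E i) x * g x \<partial>M)"
  proof (rule integral_dominated_convergence[where w="\<lambda>x. B"])
    show "AE x in M. (\<lambda>n. indicator (\<Union>i<n. E i) x * g x) \<longlonglongrightarrow> indicator (\<Union>i. E i) x * g x"
      by (intro AE_I2 tendsto_mult tendsto_const LIMSEQ_indicator_UN)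
    show "AE x in M. norm (indicator (\<Union>i<n. E i) x * g x) \<le> B" for n
      using B order_trans[OF norm_ge_zero B] by (intro AE_I2) (auto simp: indicator_def)
    show "(\<lambda>x. indicator (\<Union>i. E i) x * g x) \<in> borel_measurable M"
      using bb[of "\<Union>i. E i"] E
      by (auto simp: bounded_borel_def measurable_cong_sets[OF M(2) refl])
    show "(\<lambda>x. indicator (\<Union>i<n. E i) x * g x) \<in> borel_measurable M" for n
      using bb[of "\<Union>i<n. E i"] E
      by (auto simp: bounded_borel_def measurable_cong_sets[OF M(2) refl])
  qed auto
  moreover have "(\<integral>x. indicator (\<Union>i<n. E i) x * g x \<partial>M) = (\<Sum>i<n. \<integral>x. indicator (E i) x * g x \<partial>M)" for n
  proof -
    have "indicator (\<Union>i<n. E i) x * g x = (\<Sum>i<n. indicator (E i) x * g x)" for x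
      using indicator_UN_disjoint[of "{..<n}" E x] disj
      by (subst indicator_UN_disjoint) (auto simp: sum_distrib_right disjoint_family_on_def)
    moreover have "bounded_borel (\<lambda>x. indicator (E i) x * g x)" for i
      using E by (intro bb) auto
    ultimately show ?thesis
      by (simp only: Bochner_Integration.integral_sum integrable_bounded_borel[OF M])
  qed
  ultimately show "(\<lambda>i. \<integral>x. indicator (E i) x * g x \<partial>M) sums (\<integral>x. indicator (\<Union>i. E i) x * g x \<partial>M)"
    by (simp add: sums_def)
qed

lemma borel_sigma_additive_measure:
  assumes "finite_measure M" "sets M = sets borel"
  shows "borel_sigma_additive (\<lambda>A. measure M A)"
  unfolding borel_sigma_additive_def
  using assms finite_measure.finite_measure_UNION[OF assms(1)] by auto

text \<open>
  A finitely additive majorant of \<open>\<bar>\<nu>\<bar>\<close> sums to the same value along every partition.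
\<close>

lemma variation_le:
  fixes \<nu> :: "'a::topological_space set \<Rightarrow> complex" and m :: "'a set \<Rightarrow> real"
  assumes m: "borel_sigma_additive m" and le: "\<And>A. A \<in> sets borel \<Longrightarrow> norm (\<nu> A) \<le> m A"
    and A: "A \<in> sets borel"
  shows "variation \<nu> A \<le> ennreal (m A)"
  unfolding variation_def
proof (rule SUP_least)
  fix P assume "P \<in> {P. finite P \<and> P \<subseteq> sets borel \<and> partition_on A P}"
  then have P: "finite P" "P \<subseteq> sets borel" "\<Union>P = A" "disjoint P"
    by (auto simp: partition_on_def)
  have "m (\<Union>E\<in>P. E) = (\<Sum>E\<in>P. m E)"
    using P disjointD[OF P(4)]
    by (intro borel_sigma_additive_finite_UN[OF m]) (auto simp: disjoint_family_on_def)
  moreover have "(\<Sum>E\<in>P. norm (\<nu> E)) \<le> (\<Sum>E\<in>P. m E)"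
    using P by (intro sum_mono le) auto
  ultimately show "(\<Sum>E\<in>P. ennreal (norm (\<nu> E))) \<le> ennreal (m A)"
    using P by (simp add: sum_ennreal ennreal_leI)
qed

lemma complex_measureI:
  assumes "borel_sigma_additive \<nu>" "borel_sigma_additive m"
    "\<And>A. A \<in> sets borel \<Longrightarrow> norm (\<nu> A) \<le> m A"
  shows "complex_measure \<nu>"
proof -
  have "variation \<nu> UNIV \<le> ennreal (m UNIV)"
    by (rule variation_le[OF assms(2,3)]) simp_all
  also have "\<dots> < \<infinity>"
    by simp
  finally show ?thesis
    using assms(1) by (simp add: complex_measure_def)
qed

lemma bounded_functional_complex_integral:
  assumes "complex_measure \<mu>"
  shows "bounded_functional (complex_integral \<mu>)"
proof -
  obtain P N Q R where *: "finite_measure P" "finite_measure N" "finite_measure Q" "finite_measure R"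
    "sets P = sets borel" "sets N = sets borel" "sets Q = sets borel" "sets R = sets borel"
    "\<And>f. complex_integral \<mu> f =
       (integral\<^sup>L P f - integral\<^sup>L N f) + \<i> * (integral\<^sup>L Q f - integral\<^sup>L R f)"
    using complex_integral_Jordan[OF assms] by metis
  have "bounded_functional (\<lambda>f. 1 * (1 * integral\<^sup>L P f + (-1) * integral\<^sup>L N f) +
      \<i> * (1 * integral\<^sup>L Q f + (-1) * integral\<^sup>L R f))"
    using * by (intro bounded_functional_lincomb bounded_functional_integral)
  moreover have "complex_integral \<mu> = (\<lambda>f. 1 * (1 * integral\<^sup>L P f + (-1) * integral\<^sup>L N f) +
      \<i> * (1 * integral\<^sup>L Q f + (-1) * integral\<^sup>L R f))"
    by (rule ext) (simp add: *(9))
  ultimately show ?thesis by simp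
qed

lemma complex_integral_eqI:
  assumes "complex_measure \<mu>" "bounded_functional \<Phi>"
    "\<And>A. A \<in> sets borel \<Longrightarrow> \<Phi> (indicator A) = \<mu> A" "bounded_borel f"
  shows "complex_integral \<mu> f = \<Phi> f"
  by (rule bounded_functional_eqI[OF bounded_functional_complex_integral[OF assms(1)] assms(2)])
    (simp_all add: complex_integral_indicator assms)

text \<open>
  Estimating the four Jordan parts separately would lose a constant factor. On a simple function the
  level sets partition the space, so the definition of the variation applies with constant one, and
  uniform approximation carries the bound over to \<open>f\<close>.
\<close>

lemma norm_complex_integral_le:
  assumes \<mu>: "complex_measure \<mu>" and f: "bounded_borel f" and B: "\<And>x. norm (f x) \<le> B"
  shows "norm (complex_integral \<mu> f) \<le> B * tv_norm \<mu>"
proof -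
  note \<Phi> = bounded_functional_complex_integral[OF \<mu>]
  obtain C where C: "\<And>f B. bounded_borel f \<Longrightarrow> (\<And>x. norm (f x) \<le> B) \<Longrightarrow>
      norm (complex_integral \<mu> f) \<le> C * B"
    using bounded_functional_bound[OF \<Phi>] by blast
  have "norm (complex_integral \<mu> f) \<le> (B + \<epsilon>) * tv_norm \<mu> + C * \<epsilon>" if \<epsilon>: "\<epsilon> > 0" for \<epsilon>
  proof -
    obtain s where s: "finite (range s)" "bounded_borel s" and near: "\<And>x. norm (f x - s x) \<le> \<epsilon>"
      using uniform_simple_approximation[OF f \<epsilon>] by blast
    have meas: "s -` {c} \<in> sets borel" for c
      using s measurable_sets[of s borel borel "{c}"] by (auto simp: bounded_borel_def)
    have norm_s: "norm c \<le> B + \<epsilon>" if c: "c \<in> range s" for c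
    proof -
      obtain x where "c = s x" using c by auto
      then show ?thesis
        using norm_triangle_sub[of "s x" "f x"] near[of x] B[of x] by (simp add: norm_minus_commute)
    qed
    have pos: "0 \<le> B + \<epsilon>"
      using norm_s[of "s undefined"] norm_ge_zero order_trans by blast
    have "complex_integral \<mu> s = (\<Sum>c\<in>range s. c * \<mu> (s -` {c}))"
      by (simp add: bounded_functional_simple[OF \<Phi> s] complex_integral_indicator[OF \<mu> meas])
    then have "norm (complex_integral \<mu> s) \<le> (\<Sum>c\<in>range s. norm c * norm (\<mu> (s -` {c})))"
      by (simp add: sum_norm_le norm_mult)
    also have "\<dots> \<le> (\<Sum>c\<in>range s. (B + \<epsilon>) * norm (\<mu> (s -` {c})))"
      by (intro sum_mono mult_right_mono norm_s) auto
    also have "\<dots> = (B + \<epsilon>) * (\<Sum>c\<in>range s. norm (\<mu> (s -` {c})))"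
      by (simp add: sum_distrib_left)
    also have "\<dots> \<le> (B + \<epsilon>) * tv_norm \<mu>"
      using s(1) by (intro mult_left_mono pos sum_norm_le_tv_norm[OF \<mu>])
        (auto simp: meas disjoint_family_on_def)
    finally have "norm (complex_integral \<mu> s) \<le> (B + \<epsilon>) * tv_norm \<mu>" .
    moreover have "norm (complex_integral \<mu> (\<lambda>x. f x - s x)) \<le> C * \<epsilon>"
      using bounded_borel_add[OF f bounded_borel_mult[OF bounded_borel_const[of "-1"] s(2)]]
      by (intro C near) simp
    moreover have "complex_integral \<mu> f = complex_integral \<mu> s + complex_integral \<mu> (\<lambda>x. f x - s x)"
      by (simp add: bounded_functional_diff[OF \<Phi> f s(2)])
    ultimately show ?thesis
      using norm_triangle_ineq[of "complex_integral \<mu> s" "complex_integral \<mu> (\<lambda>x. f x - s x)"] by simp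
  qed
  then have "\<forall>\<^sub>F \<epsilon> in at_right 0. norm (complex_integral \<mu> f) \<le> (B + \<epsilon>) * tv_norm \<mu> + C * \<epsilon>"
    by (auto intro: eventually_mono[OF eventually_at_right_less])
  moreover have "((\<lambda>\<epsilon>. (B + \<epsilon>) * tv_norm \<mu> + C * \<epsilon>) \<longlongrightarrow> (B + 0) * tv_norm \<mu> + C * 0) (at_right 0)"
    by (intro tendsto_intros)
  ultimately have "norm (complex_integral \<mu> f) \<le> (B + 0) * tv_norm \<mu> + C * 0"
    by (intro tendsto_lowerbound[where F="at_right (0::real)"]) auto
  then show ?thesis by simp
qed

lemma complex_measure_density:
  assumes \<mu>: "complex_measure \<mu>" and g: "bounded_borel g"
  shows "complex_measure (\<lambda>A. complex_integral \<mu> (\<lambda>x. indicator A x * g x))"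
proof -
  obtain P N Q R where *: "finite_measure P" "finite_measure N" "finite_measure Q" "finite_measure R"
    "sets P = sets borel" "sets N = sets borel" "sets Q = sets borel" "sets R = sets borel"
    "\<And>f. complex_integral \<mu> f =
       (integral\<^sup>L P f - integral\<^sup>L N f) + \<i> * (integral\<^sup>L Q f - integral\<^sup>L R f)"
    using complex_integral_Jordan[OF \<mu>] by metis
  obtain B where B: "\<And>x. norm (g x) \<le> B"
    using g by (auto simp: bounded_borel_def)
  let ?I = "\<lambda>M A. (\<integral>x. indicator A x * g x \<partial>M)"
  have le: "norm (?I M A) \<le> B * measure M A"
    if "finite_measure M" "sets M = sets borel" "A \<in> sets borel" for M A
  proof -
    have A: "bounded_borel (\<lambda>x. indicator A x * g x)"
      using that g by (intro bounded_borel_mult bounded_borel_indicator)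
    have "norm (?I M A) \<le> (\<integral>x. norm (indicator A x * g x) \<partial>M)"
      by (rule integral_norm_bound)
    also have "\<dots> \<le> (\<integral>x. indicator A x * B \<partial>M)"
    proof (rule integral_mono)
      show "integrable M (\<lambda>x. norm (indicator A x * g x))"
        using integrable_bounded_borel[OF that(1,2) A] by (rule integrable_norm)
      show "integrable M (\<lambda>x. indicator A x * B)"
        using that finite_measure.emeasure_finite[OF that(1)]
        by (intro integrable_mult_left integrable_real_indicator) (auto simp: less_top)
    qed (auto simp: indicator_def B)
    also have "\<dots> = B * measure M A"
      using sets_eq_imp_space_eq[OF that(2)] by simp
    finally show ?thesis .
  qed
  let ?m = "\<lambda>A. 1 * (B * measure P A + B * measure N A) + 1 * (B * measure Q A + B * measure R A)"
  let ?\<nu> = "\<lambda>A. 1 * (1 * ?I P A + (-1) * ?I N A) + \<i> * (1 * ?I Q A + (-1) * ?I R A)"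
  have "complex_measure ?\<nu>"
  proof (rule complex_measureI[where m="?m"])
    show "borel_sigma_additive ?\<nu>"
      using * g by (intro borel_sigma_additive_lincomb borel_sigma_additive_integral)
    show "borel_sigma_additive ?m"
      using * by (intro borel_sigma_additive_lincomb borel_sigma_additive_measure)
    show "norm (?\<nu> A) \<le> ?m A" if A: "A \<in> sets borel" for A
    proof -
      have "norm (?\<nu> A) \<le> (norm (?I P A) + norm (?I N A)) + (norm (?I Q A) + norm (?I R A))"
        using norm_triangle_ineq4[of "?I P A" "?I N A"] norm_triangle_ineq4[of "?I Q A" "?I R A"]
          norm_triangle_ineq[of "?I P A - ?I N A" "\<i> * (?I Q A - ?I R A)"]
        by (simp add: norm_mult)
      also have "\<dots> \<le> (B * measure P A + B * measure N A) + (B * measure Q A + B * measure R A)"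
        using * A by (intro add_mono le)
      finally show ?thesis by simp
    qed
  qed
  then show ?thesis
    by (simp add: *(9))
qed

text \<open>
  Both sides are bounded functionals of \<open>f\<close>, and for an indicator they agree by the definition of the
  measure with density \<open>g\<close>.
\<close>

lemma complex_integral_density:
  assumes \<mu>: "complex_measure \<mu>" and g: "bounded_borel g" and f: "bounded_borel f"
  shows "complex_integral (\<lambda>A. complex_integral \<mu> (\<lambda>x. indicator A x * g x)) f =
    complex_integral \<mu> (\<lambda>x. f x * g x)"
  using bounded_functional_mult[OF bounded_functional_complex_integral[OF \<mu>] g]
  by (rule complex_integral_eqI[OF complex_measure_density[OF \<mu> g] _ _ f]) auto

section \<open>The torus and its characters\<close>

lemma continuous_abs_circle: "continuous_on UNIV abs_circle"
  by (simp add: continuous_on_open_vimage open_circle_def)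

lemma continuous_circle_character: "continuous_on UNIV (circle_character k)"
proof -
  have "open (circle_character k -` B)" if "open B" for B
  proof -
    have "continuous_on UNIV (\<lambda>t. exp (2 * of_real pi * \<i> * of_int k * complex_of_real t))"
      by (intro continuous_intros)
    then have "open ((\<lambda>t. exp (2 * of_real pi * \<i> * of_int k * complex_of_real t)) -` B)"
      using that by (simp add: continuous_on_open_vimage)
    moreover have "(\<lambda>t. exp (2 * of_real pi * \<i> * of_int k * complex_of_real t)) -` B =
        abs_circle -` (circle_character k -` B)"
      by (auto simp: circle_character.abs_eq)
    ultimately show ?thesis
      by (simp add: open_circle_def)
  qed
  then show ?thesis
    by (simp add: continuous_on_open_vimage)
qed

lemma continuous_on_vec_nth_UNIV:
  "continuous_on UNIV (\<lambda>x :: 'a::topological_space ^ 'd::finite. x $ i)"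
  unfolding continuous_on_def by (auto intro: tendsto_vec_nth)

lemma continuous_on_vec_lambda_UNIV:
  fixes f :: "'a::topological_space \<Rightarrow> 'd::finite \<Rightarrow> 'b::topological_space"
  assumes "\<And>i. continuous_on UNIV (\<lambda>x. f x i)"
  shows "continuous_on UNIV (\<lambda>x. \<chi> i. f x i)"
  using assms unfolding continuous_on_def by (auto intro: tendsto_vec_lambda)

lemma continuous_character: "continuous_on UNIV (character m)"
proof -
  have "continuous_on UNIV (\<lambda>x :: 'a torus. circle_character (m $ i) (x $ i))" for i
    by (rule continuous_on_compose2[OF continuous_circle_character continuous_on_vec_nth_UNIV]) simp
  then have "continuous_on UNIV (\<lambda>x. \<Prod>i\<in>UNIV. circle_character (m $ i) (x $ i))"
    by (intro continuous_on_prod)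
  moreover have "character m = (\<lambda>x. \<Prod>i\<in>UNIV. circle_character (m $ i) (x $ i))"
    by (rule ext) (simp add: character_def)
  ultimately show ?thesis by simp
qed

lemma norm_circle_character [simp]: "norm (circle_character k t) = 1"
  by (transfer) (simp add: norm_exp_eq_Re)

lemma norm_character [simp]: "norm (character m x) = 1"
  by (simp add: character_def prod_norm[symmetric])

lemma circle_character_add: "circle_character (j + k) t = circle_character j t * circle_character k t"
  by transfer (simp add: exp_add[symmetric] algebra_simps)

lemma circle_character_0 [simp]: "circle_character 0 t = 1"
  by transfer simp

lemma character_add: "character (m + n) x = character m x * character n x"
  by (simp add: character_def circle_character_add prod.distrib)

lemma character_0 [simp]: "character 0 x = 1"
  by (simp add: character_def)

lemma bounded_borel_character: "bounded_borel (character m)"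
  by (rule bounded_borelI[where B=1])
    (auto intro: borel_measurable_continuous_onI continuous_character)

lemma circle_character_1_inject:
  assumes "circle_character 1 x = circle_character 1 y"
  shows "x = y"
  using assms
proof transfer
  fix s t :: real
  assume "exp (2 * of_real pi * \<i> * of_int 1 * complex_of_real s) =
    exp (2 * of_real pi * \<i> * of_int 1 * complex_of_real t)"
  then obtain n :: int where
    "2 * of_real pi * \<i> * of_int 1 * complex_of_real s =
      2 * of_real pi * \<i> * of_int 1 * complex_of_real t + of_int (2 * n) * of_real pi * \<i>"
    unfolding exp_eq by auto
  then have "Im (2 * of_real pi * \<i> * of_int 1 * complex_of_real s) =
      Im (2 * of_real pi * \<i> * of_int 1 * complex_of_real t + of_int (2 * n) * of_real pi * \<i>)"
    by simp
  then have "pi * (s - t) = pi * of_int n"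
    by (simp add: algebra_simps)
  then have "s - t = of_int n"
    by simp
  then show "s - t \<in> \<int>"
    by simp
qed

text \<open>
  The coordinate characters of frequency one separate points, so they embed the torus continuously and
  injectively into the Hausdorff space \<open>\<complex>\<^sup>d\<close>. A compact set is the preimage of its image, which is
  compact and hence closed.
\<close>

lemma compact_imp_closed_torus:
  fixes K :: "'d::finite torus set"
  assumes "compact K"
  shows "closed K"
proof -
  define h :: "'d torus \<Rightarrow> complex ^ 'd" where "h x = (\<chi> i. circle_character 1 (x $ i))" for x
  have h: "continuous_on UNIV h"
    unfolding h_def
    by (intro continuous_on_vec_lambda_UNIV
        continuous_on_compose2[OF continuous_circle_character continuous_on_vec_nth_UNIV]) simp
  have inj: "inj h"
    by (auto simp: inj_on_def h_def vec_eq_iff intro: circle_character_1_inject)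
  have "compact (h ` K)"
    using assms continuous_on_subset[OF h] by (intro compact_continuous_image) auto
  then have "closed (h ` K)"
    by (rule compact_imp_closed)
  then have "closed (h -` (h ` K))"
    using h by (intro closed_vimage)
  then show ?thesis
    by (simp add: inj_vimage_image_eq[OF inj])
qed

section \<open>A space-filling curve\<close>

text \<open>
  A continuous function of period two that vanishes on \<open>[0, 1/3]\<close> and equals one on \<open>[2/3, 1]\<close>. It reads
  off the leading digit of a ternary expansion with digits zero and two.
\<close>

definition ramp :: "real \<Rightarrow> real"
  where "ramp t = max 0 (min 1 (1 / 2 - cos (pi * t)))"

lemma ramp_bounds: "0 \<le> ramp t" "ramp t \<le> 1"
  by (auto simp: ramp_def)

lemma ramp_add_even: "ramp (2 * real z + t) = ramp t"
proof -
  have "cos (pi * (2 * real z + t)) = cos (2 * real z * pi + pi * t)"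
    by (simp add: algebra_simps)
  also have "\<dots> = cos (pi * t)"
    by (simp add: cos_add)
  finally show ?thesis by (simp add: ramp_def)
qed

lemma ramp_eq_0: "0 \<le> t \<Longrightarrow> t \<le> 1 / 3 \<Longrightarrow> ramp t = 0"
proof -
  assume t: "0 \<le> t" "t \<le> 1 / 3"
  have "cos (pi / 3) \<le> cos (pi * t)"
    using t by (intro cos_monotone_0_pi_le) auto
  then show ?thesis by (simp add: ramp_def cos_60)
qed

lemma ramp_eq_1: "2 / 3 \<le> t \<Longrightarrow> t \<le> 1 \<Longrightarrow> ramp t = 1"
proof -
  assume t: "2 / 3 \<le> t" "t \<le> 1"
  have "cos (pi * t) \<le> cos (pi * (2 / 3))"
    using t by (intro cos_monotone_0_pi_le) auto
  moreover have "cos (pi * (2 / 3)) = - 1 / 2"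
    using cos_120 by (simp add: mult.commute)
  ultimately show ?thesis by (simp add: ramp_def)
qed

text \<open>
  The point of the Cantor set with ternary digits \<open>2 * b n\<close>.
\<close>

definition ternary :: "(nat \<Rightarrow> real) \<Rightarrow> real"
  where "ternary b = (\<Sum>n. 2 * b n * (1 / 3) ^ Suc n)"

context
  fixes b :: "nat \<Rightarrow> real"
  assumes bits: "\<And>n. b n \<in> {0, 1}"
begin

lemma summable_ternary: "summable (\<lambda>n. 2 * b n * (1 / 3) ^ Suc n)"
proof (rule summable_comparison_test)
  have "norm (2 * b n * (1 / 3) ^ Suc n) \<le> (1 / 3 :: real) ^ n" for n
    using bits[of n] by auto
  then show "\<exists>N. \<forall>n\<ge>N. norm (2 * b n * (1 / 3) ^ Suc n) \<le> (1 / 3 :: real) ^ n"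
    by blast
  show "summable (\<lambda>n. (1 / 3 :: real) ^ n)"
    by (simp add: summable_geometric)
qed

lemma ternary_bounds: "0 \<le> ternary b" "ternary b \<le> 1"
proof -
  have "0 \<le> 2 * b n * (1 / 3) ^ Suc n" for n
    using bits[of n] by auto
  then show "0 \<le> ternary b"
    unfolding ternary_def by (intro suminf_nonneg summable_ternary)
  have "2 * b n * (1 / 3) ^ Suc n \<le> 2 / 3 * (1 / 3) ^ n" for n
    using bits[of n] by auto
  then have "ternary b \<le> (\<Sum>n. 2 / 3 * (1 / 3 :: real) ^ n)"
    unfolding ternary_def by (intro suminf_le summable_ternary summable_mult summable_geometric) auto
  also have "\<dots> = 1"
    using sums_mult[OF geometric_sums[of "1 / 3 :: real"], of "2 / 3"]
    by (intro sums_unique[symmetric]) simp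
  finally show "ternary b \<le> 1" .
qed

lemma ternary_shift: "3 * ternary b = 2 * b 0 + ternary (\<lambda>n. b (Suc n))"
proof -
  have "ternary b = 2 * b 0 * (1 / 3) ^ Suc 0 + (\<Sum>n. 2 * b (Suc n) * (1 / 3) ^ Suc (Suc n))"
    unfolding ternary_def using suminf_split_head[OF summable_ternary] by simp
  also have "(\<Sum>n. 2 * b (Suc n) * (1 / 3) ^ Suc (Suc n)) =
      (\<Sum>n. 1 / 3 * (2 * b (Suc n) * (1 / 3) ^ Suc n))"
    by (simp add: mult_ac)
  also have "\<dots> = 1 / 3 * ternary (\<lambda>n. b (Suc n))"
  proof -
    have "summable (\<lambda>n. 3 * (2 * b (Suc n) * (1 / 3) ^ Suc (Suc n)))"
      using summable_ternary by (intro summable_mult) (subst summable_Suc_iff)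
    then have "summable (\<lambda>n. 2 * b (Suc n) * (1 / 3) ^ Suc n)"
      by (simp add: mult_ac)
    then show ?thesis
      unfolding ternary_def by (rule suminf_mult)
  qed
  finally show ?thesis by simp
qed

end

text \<open>
  Multiplication by \<open>3 ^ n\<close> moves digit \<open>n\<close> to the front. The digits before it contribute an even
  integer, which the periodicity of \<open>ramp\<close> removes.
\<close>

lemma ramp_ternary:
  assumes "\<And>n. b n \<in> {0, 1}"
  shows "ramp (3 ^ n * ternary b) = b n"
proof -
  have "\<exists>z. 3 ^ n * ternary b = 2 * real z + ternary (\<lambda>k. b (k + n))"
  proof (induction n)
    case 0
    show ?case by (auto intro: exI[of _ 0])
  next
    case (Suc n)
    then obtain z where z: "3 ^ n * ternary b = 2 * real z + ternary (\<lambda>k. b (k + n))" by blast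
    obtain w :: nat where w: "b n = real w"
      using assms[of n] of_nat_0 of_nat_1 by (metis insert_iff singletonD)
    have "3 ^ Suc n * ternary b = 3 * (2 * real z + ternary (\<lambda>k. b (k + n)))"
      by (simp add: z[symmetric])
    also have "\<dots> = 2 * real (3 * z + w) + ternary (\<lambda>k. b (k + Suc n))"
      using ternary_shift[of "\<lambda>k. b (k + n)"] assms by (simp add: w)
    finally show ?case by blast
  qed
  then obtain z where "3 ^ n * ternary b = 2 * real z + ternary (\<lambda>k. b (k + n))" by blast
  then have "ramp (3 ^ n * ternary b) = ramp (ternary (\<lambda>k. b (k + n)))"
    by (simp add: ramp_add_even)
  also have "\<dots> = b n"
  proof -
    have "3 * ternary (\<lambda>k. b (k + n)) = 2 * b n + ternary (\<lambda>k. b (Suc k + n))"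
      using ternary_shift[of "\<lambda>k. b (k + n)"] assms by simp
    moreover have "0 \<le> ternary (\<lambda>k. b (Suc k + n))" "ternary (\<lambda>k. b (Suc k + n)) \<le> 1"
      by (rule ternary_bounds, rule assms)+
    moreover have "b n = 0 \<or> b n = 1"
      using assms[of n] by simp
    ultimately show ?thesis
      using ramp_eq_0[of "ternary (\<lambda>k. b (k + n))"] ramp_eq_1[of "ternary (\<lambda>k. b (k + n))"] by auto
  qed
  finally show ?thesis .
qed

lemma binary_expansion:
  fixes x :: real
  assumes "0 \<le> x" "x < 1"
  obtains b :: "nat \<Rightarrow> real" where "\<And>k. b k \<in> {0, 1}" "(\<lambda>k. (1 / 2) ^ Suc k * b k) sums x"
proof -
  define b :: "nat \<Rightarrow> real" where "b k = of_int (\<lfloor>2 ^ Suc k * x\<rfloor> mod 2)" for k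
  have part: "(\<Sum>k<n. (1 / 2) ^ Suc k * b k) = (1 / 2) ^ n * of_int \<lfloor>2 ^ n * x\<rfloor>" for n
  proof (induction n)
    case 0
    have "\<lfloor>x\<rfloor> = 0" using assms by linarith
    then show ?case by simp
  next
    case (Suc n)
    have "\<lfloor>2 ^ Suc n * x\<rfloor> div 2 = \<lfloor>2 ^ n * x\<rfloor>"
      using floor_divide_real_eq_div[of 2 "2 ^ Suc n * x"] by simp
    then have "\<lfloor>2 ^ Suc n * x\<rfloor> = 2 * \<lfloor>2 ^ n * x\<rfloor> + \<lfloor>2 ^ Suc n * x\<rfloor> mod 2"
      by presburger
    then have "real_of_int \<lfloor>2 ^ Suc n * x\<rfloor> = 2 * real_of_int \<lfloor>2 ^ n * x\<rfloor> + b n"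
      unfolding b_def by (metis of_int_add of_int_mult of_int_numeral)
    then show ?case
      using Suc by (simp add: algebra_simps)
  qed
  have "(\<lambda>n. (1 / 2) ^ n * of_int \<lfloor>2 ^ n * x\<rfloor>) \<longlonglongrightarrow> x"
  proof (rule tendsto_sandwich)
    have "x - (1 / 2) ^ n \<le> (1 / 2) ^ n * of_int \<lfloor>2 ^ n * x\<rfloor> \<and>
        (1 / 2) ^ n * of_int \<lfloor>2 ^ n * x\<rfloor> \<le> x" for n
    proof -
      have "(1 / 2) ^ n * (2 ^ n * x - 1) \<le> (1 / 2) ^ n * of_int \<lfloor>2 ^ n * x\<rfloor>"
        "(1 / 2) ^ n * of_int \<lfloor>2 ^ n * x\<rfloor> \<le> (1 / 2) ^ n * (2 ^ n * x)"
        by (intro mult_left_mono; linarith | simp)+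
      moreover have "(1 / 2) ^ n * (2 ^ n * x) = x"
        by (simp add: power_divide)
      ultimately show ?thesis
        by (simp add: right_diff_distrib)
    qed
    then show "\<forall>\<^sub>F n in sequentially. x - (1 / 2) ^ n \<le> (1 / 2) ^ n * of_int \<lfloor>2 ^ n * x\<rfloor>"
      "\<forall>\<^sub>F n in sequentially. (1 / 2) ^ n * of_int \<lfloor>2 ^ n * x\<rfloor> \<le> x"
      by auto
    have "(\<lambda>n. x - (1 / 2) ^ n) \<longlonglongrightarrow> x - 0"
      by (intro tendsto_intros LIMSEQ_power_zero) auto
    then show "(\<lambda>n. x - (1 / 2) ^ n) \<longlonglongrightarrow> x" by simp
  qed auto
  then have "(\<lambda>k. (1 / 2) ^ Suc k * b k) sums x"
    by (simp only: sums_def part)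
  moreover have "b k \<in> {0, 1}" for k
  proof -
    have "\<lfloor>2 ^ Suc k * x\<rfloor> mod 2 = 0 \<or> \<lfloor>2 ^ Suc k * x\<rfloor> mod 2 = 1"
      by presburger
    then show ?thesis
      unfolding b_def by auto
  qed
  ultimately show thesis by (intro that)
qed

text \<open>
  A coordinate of Schoenberg's space-filling curve: its binary digit \<open>k\<close> is read from the ternary digit
  \<open>d k\<close> of \<open>t\<close>.
\<close>

definition Schoenberg :: "(nat \<Rightarrow> nat) \<Rightarrow> real \<Rightarrow> real"
  where "Schoenberg d t = (\<Sum>k. (1 / 2) ^ Suc k * ramp (3 ^ d k * t))"

lemma continuous_Schoenberg: "continuous_on UNIV (Schoenberg d)"
proof -
  have "continuous_on UNIV (\<lambda>t. ramp (3 ^ d k * t))" for k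
    unfolding ramp_def by (intro continuous_intros)
  then have part: "continuous_on UNIV (\<lambda>t. \<Sum>k<n. (1 / 2) ^ Suc k * ramp (3 ^ d k * t))" for n
    by (intro continuous_on_sum continuous_on_mult continuous_on_const)
  have "uniform_limit UNIV (\<lambda>n t. \<Sum>k<n. (1 / 2) ^ Suc k * ramp (3 ^ d k * t))
      (\<lambda>t. \<Sum>k. (1 / 2) ^ Suc k * ramp (3 ^ d k * t)) sequentially"
  proof (rule Weierstrass_m_test)
    show "norm ((1 / 2) ^ Suc k * ramp (3 ^ d k * t)) \<le> (1 / 2) ^ k" for k t
      using ramp_bounds[of "3 ^ d k * t"] by (simp add: abs_mult)
    show "summable (\<lambda>k. (1 / 2 :: real) ^ k)"
      by (simp add: summable_geometric)
  qed
  then have "continuous_on UNIV (\<lambda>t. \<Sum>k. (1 / 2) ^ Suc k * ramp (3 ^ d k * t))"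
    by (rule uniform_limit_theorem[OF always_eventually[OF allI[OF part]]]) simp
  then show ?thesis
    unfolding Schoenberg_def .
qed

text \<open>
  Since \<open>d\<close> is injective, the binary digits of all coordinates can be interleaved in a single ternary
  expansion.
\<close>

lemma Schoenberg_space_filling:
  fixes d :: "'d \<Rightarrow> nat \<Rightarrow> nat" and x :: "'d \<Rightarrow> real"
  assumes d: "inj (\<lambda>(i, k). d i k)" and x: "\<And>i. 0 \<le> x i" "\<And>i. x i < 1"
  obtains t where "0 \<le> t" "t \<le> 1" "\<And>i. Schoenberg (d i) t = x i"
proof -
  have "\<forall>i. \<exists>b. (\<forall>k. b k \<in> {0, 1}) \<and> (\<lambda>k. (1 / 2) ^ Suc k * b k) sums x i"
    using x by (metis binary_expansion)
  then obtain b where b: "\<And>i k. b i k \<in> {0, 1 :: real}"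
    "\<And>i. (\<lambda>k. (1 / 2) ^ Suc k * b i k) sums x i"
    by metis
  \<comment> \<open>Ternary positions that no coordinate uses carry the digit zero.\<close>
  define c where "c n = (if n \<in> range (\<lambda>(i, k). d i k)
    then case_prod b (inv (\<lambda>(i, k). d i k) n) else 0)" for n
  have c: "c n \<in> {0, 1}" for n
    using b(1) by (auto simp: c_def split: prod.splits)
  have c_d: "c (d i k) = b i k" for i k
    using inv_f_f[OF d, of "(i, k)"] by (auto simp: c_def)
  have "Schoenberg (d i) (ternary c) = x i" for i
    using b(2)[of i] by (simp add: Schoenberg_def ramp_ternary[OF c] c_d sums_iff)
  then show thesis
    using ternary_bounds[OF c] by (intro that[of "ternary c"])
qed

section \<open>Positive-definite sequences on finite grids\<close>

text \<open>
  The character \<open>m\<close> at the point of the torus with coordinates \<open>u i / N\<close>.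
\<close>

definition grid_character :: "nat \<Rightarrow> int ^ 'd \<Rightarrow> ('d::finite \<Rightarrow> nat) \<Rightarrow> complex"
  where "grid_character N m u = (\<Prod>i\<in>UNIV. cis (2 * pi * of_int (m $ i) * (real (u i) / real N)))"

lemma grid_character_add:
  "grid_character N (m + n) u = grid_character N m u * grid_character N n u"
  by (simp add: grid_character_def prod.distrib[symmetric] cis_mult distrib_left distrib_right
      add_divide_distrib)

lemma grid_character_minus: "grid_character N (- m) u = cnj (grid_character N m u)"
  by (simp add: grid_character_def cis_cnj)

lemma grid_character_0 [simp]: "grid_character N 0 u = 1"
  by (simp add: grid_character_def)

lemma sum_cis_multiples:
  assumes "\<bar>k\<bar> < int N"
  shows "(\<Sum>v<N. cis (2 * pi * of_int k * (real v / real N))) = (if k = 0 then of_nat N else 0)"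
proof (cases "k = 0")
  case False
  have N: "N > 0" using assms by auto
  define z where "z = cis (2 * pi * (of_int k / real N))"
  have pow: "z ^ v = cis (2 * pi * of_int k * (real v / real N))" for v
    unfolding z_def Complex.DeMoivre by (rule arg_cong[where f=cis]) simp
  have "z ^ N = cis (2 * pi * of_int k)"
    using N by (simp add: pow)
  then have zN: "z ^ N = 1"
    using cis_multiple_2pi[of "of_int k"] by simp
  have "z \<noteq> 1"
  proof
    assume "z = 1"
    then have "cos (2 * pi * (of_int k / real N)) = 1"
      by (simp add: z_def complex_eq_iff)
    then obtain j :: int where "2 * pi * (of_int k / real N) = of_int j * 2 * pi"
      by (auto simp: cos_one_2pi_int)
    then have "(2 * pi) * (of_int k / real N) = (2 * pi) * of_int j"
      by (simp only: mult_ac)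
    then have "of_int k / real N = real_of_int j"
      unfolding mult_cancel_left by simp
    then have "real_of_int k = of_int j * real N"
      using N by (simp add: field_simps)
    then have "k = j * int N"
      by (metis of_int_eq_iff of_int_mult of_int_of_nat_eq)
    then have "int N dvd k" by simp
    then show False
      using False assms zdvd_imp_le[of "int N" "\<bar>k\<bar>"] by simp
  qed
  then have "(\<Sum>v<N. z ^ v) = 0"
    by (simp add: geometric_sum zN)
  then show ?thesis
    using False by (simp add: pow)
qed simp

text \<open>
  Orthogonality of characters on the group of grid points. The bound on \<open>m\<close> excludes aliasing, that is,
  nonzero frequencies that are divisible by \<open>N\<close> in each coordinate.
\<close>

lemma sum_grid_character:
  fixes m :: "int ^ 'd::finite"
  assumes "\<And>i. \<bar>m $ i\<bar> < int N"
  shows "(\<Sum>u\<in>PiE UNIV (\<lambda>_. {..<N}). grid_character N m u) = (if m = 0 then of_nat N ^ CARD('d) else 0)"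
proof -
  have "(\<Sum>u\<in>PiE UNIV (\<lambda>_. {..<N}). grid_character N m u) =
      (\<Prod>i\<in>UNIV. \<Sum>v<N. cis (2 * pi * of_int (m $ i) * (real v / real N)))"
    unfolding grid_character_def by (rule prod_sum_PiE[symmetric]) auto
  also have "\<dots> = (\<Prod>i\<in>(UNIV :: 'd set). if m $ i = 0 then of_nat N else 0)"
    by (intro prod.cong refl sum_cis_multiples assms)
  also have "\<dots> = (if m = 0 then of_nat N ^ CARD('d) else 0)"
    by (auto simp: vec_eq_iff intro: prod_zero)
  finally show ?thesis .
qed

definition lattice_cube :: "nat \<Rightarrow> (int ^ 'd) set"
  where "lattice_cube L = {v. \<forall>i. 0 \<le> v $ i \<and> v $ i < int L}"

lemma bij_betw_vec_lambda_PiE: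
  fixes B :: "'d::finite \<Rightarrow> 'a set"
  shows "bij_betw vec_lambda (PiE UNIV B) {v. \<forall>i. v $ i \<in> B i}"
  by (rule bij_betw_byWitness[where f'=vec_nth]) auto

lemma finite_lattice_cube: "finite (lattice_cube L :: (int ^ 'd::finite) set)"
proof -
  have "finite (PiE (UNIV :: 'd set) (\<lambda>_. {0..<int L}))"
    by (intro finite_PiE) auto
  then have "finite {v :: int ^ 'd. \<forall>i. v $ i \<in> {0..<int L}}"
    using bij_betw_finite[OF bij_betw_vec_lambda_PiE[of "\<lambda>_. {0..<int L}"]] by blast
  then show ?thesis
    by (simp add: lattice_cube_def)
qed

lemma card_lattice_cube_shift:
  fixes m :: "int ^ 'd::finite"
  assumes "\<And>i. \<bar>m $ i\<bar> \<le> int L"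
  shows "real (card {k \<in> lattice_cube L. k + m \<in> lattice_cube L}) = (\<Prod>i\<in>UNIV. (real L - of_int \<bar>m $ i\<bar>))"
proof -
  let ?B = "\<lambda>i. {max 0 (- m $ i)..<min (int L) (int L - m $ i)}"
  have coordinate: "x \<in> {max 0 (- y)..<min (int L) (int L - y)} \<longleftrightarrow>
      (0 \<le> x \<and> x < int L) \<and> 0 \<le> x + y \<and> x + y < int L" for x y :: int
    by auto
  have "{k \<in> lattice_cube L. k + m \<in> lattice_cube L} = {v. \<forall>i. v $ i \<in> ?B i}"
    unfolding lattice_cube_def mem_Collect_eq coordinate vector_add_component all_conj_distrib by blast
  then have "card {k \<in> lattice_cube L. k + m \<in> lattice_cube L} = (\<Prod>i\<in>UNIV. card (?B i))"
    using bij_betw_same_card[OF bij_betw_vec_lambda_PiE[of ?B]] by (simp add: card_PiE)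
  moreover have "real (card (?B i)) = real L - of_int \<bar>m $ i\<bar>" for i
  proof -
    have "min (int L) (int L - m $ i) - max 0 (- m $ i) = int L - \<bar>m $ i\<bar>"
      by auto
    then show ?thesis
      using assms[of i] by simp
  qed
  ultimately show ?thesis by simp
qed

text \<open>
  The definition of \<open>positive_definite\<close> sums over the exact support of the test sequence; any finite
  set that contains the support gives the same sum.
\<close>

lemma positive_definite_sum:
  assumes "positive_definite a" "finite S"
  shows "(\<Sum>j\<in>S. \<Sum>k\<in>S. a (j - k) * b j * cnj (b k)) \<in> \<real>\<^sub>\<ge>\<^sub>0"
proof -
  define c where "c j = (if j \<in> S then b j else 0)" for j
  define T where "T = {j. c j \<noteq> 0}"
  have T: "T \<subseteq> S" and c_T: "\<And>j. j \<in> S - T \<Longrightarrow> c j = 0"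
    by (auto simp: T_def c_def split: if_splits)
  have "(\<Sum>j\<in>T. \<Sum>k\<in>T. a (j - k) * c j * cnj (c k)) \<in> \<real>\<^sub>\<ge>\<^sub>0"
    using assms(1)[unfolded positive_definite_def, THEN spec, of c] finite_subset[OF T assms(2)]
    unfolding T_def by (rule mp)
  also have "(\<Sum>j\<in>T. \<Sum>k\<in>T. a (j - k) * c j * cnj (c k)) =
      (\<Sum>j\<in>T. \<Sum>k\<in>S. a (j - k) * c j * cnj (c k))"
    by (intro sum.cong refl sum.mono_neutral_left assms(2) T) (simp add: c_T)
  also have "\<dots> = (\<Sum>j\<in>S. \<Sum>k\<in>S. a (j - k) * c j * cnj (c k))"
    by (intro sum.mono_neutral_left assms(2) T) (simp add: c_T)
  also have "\<dots> = (\<Sum>j\<in>S. \<Sum>k\<in>S. a (j - k) * b j * cnj (b k))"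
    by (intro sum.cong refl) (simp add: c_def)
  finally show ?thesis .
qed

lemma positive_definite_0:
  assumes "positive_definite a"
  shows "a 0 \<in> \<real>\<^sub>\<ge>\<^sub>0"
  using positive_definite_sum[OF assms, of "{0}" "\<lambda>_. 1"] by simp

text \<open>
  Testing positive definiteness with the characters \<open>j \<mapsto> e\<^sup>2\<^sup>\<pi>\<^sup>i\<^sup>j\<^sup>\<cdot>\<^sup>x\<close> on the cube \<open>{0..<L}\<^sup>d\<close> shows that
  \<open>F x = (\<Sum>j k. a (j - k) e\<^sup>2\<^sup>\<pi>\<^sup>i\<^sup>(\<^sup>j\<^sup>-\<^sup>k\<^sup>)\<^sup>\<cdot>\<^sup>x)\<close> is nonnegative. Its coefficient at \<open>m\<close> is \<open>a m\<close> times the number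
  of pairs in the cube with difference \<open>m\<close>, which after division by \<open>L\<^sup>d\<close> is the Fejer factor. The
  frequencies \<open>j - k - m\<close> have coordinates below \<open>2 * L\<close> in absolute value, so a grid with \<open>2 * L\<close> points
  in each direction computes the coefficients exactly.
\<close>

lemma discrete_Fejer_weights:
  fixes a :: "int ^ 'd::finite \<Rightarrow> complex"
  assumes a: "positive_definite a" and L: "L > 0"
  obtains w :: "('d \<Rightarrow> nat) \<Rightarrow> real" where "\<And>u. 0 \<le> w u"
    "\<And>m. \<forall>i. \<bar>m $ i\<bar> \<le> int L \<Longrightarrow>
      (\<Sum>u\<in>PiE UNIV (\<lambda>_. {..<2 * L}). of_real (w u) * grid_character (2 * L) (- m) u) =
      a m * of_real (\<Prod>i\<in>UNIV. (1 - of_int \<bar>m $ i\<bar> / real L))"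
proof -
  let ?N = "2 * L" and ?S = "lattice_cube L :: (int ^ 'd) set" and ?G = "PiE (UNIV :: 'd set) (\<lambda>_. {..<2 * L})"
  let ?\<chi> = "grid_character (2 * L)"
  define F where "F u = (\<Sum>j\<in>?S. \<Sum>k\<in>?S. a (j - k) * ?\<chi> j u * cnj (?\<chi> k u))" for u
  have F: "F u \<in> \<real>\<^sub>\<ge>\<^sub>0" for u
    unfolding F_def by (intro positive_definite_sum a finite_lattice_cube)
  have coeff: "(\<Sum>u\<in>?G. F u * ?\<chi> (- m) u) =
      of_nat (?N ^ CARD('d)) * (a m * of_nat (card {k \<in> ?S. k + m \<in> ?S}))"
    if m: "\<And>i. \<bar>m $ i\<bar> \<le> int L" for m
  proof -
    have "(\<Sum>u\<in>?G. F u * ?\<chi> (- m) u) =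
        (\<Sum>u\<in>?G. \<Sum>j\<in>?S. \<Sum>k\<in>?S. a (j - k) * ?\<chi> (j - k - m) u)"
    proof (intro sum.cong refl)
      fix u
      have "?\<chi> (j - k - m) u = ?\<chi> j u * cnj (?\<chi> k u) * ?\<chi> (- m) u" for j k
        using grid_character_add[of ?N "j + - k" "- m" u] grid_character_add[of ?N j "- k" u]
        by (simp add: grid_character_minus)
      then show "F u * ?\<chi> (- m) u = (\<Sum>j\<in>?S. \<Sum>k\<in>?S. a (j - k) * ?\<chi> (j - k - m) u)"
        by (simp add: F_def sum_distrib_right mult.assoc)
    qed
    also have "\<dots> = (\<Sum>j\<in>?S. \<Sum>u\<in>?G. \<Sum>k\<in>?S. a (j - k) * ?\<chi> (j - k - m) u)"
      by (rule sum.swap)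
    also have "\<dots> = (\<Sum>j\<in>?S. \<Sum>k\<in>?S. \<Sum>u\<in>?G. a (j - k) * ?\<chi> (j - k - m) u)"
      by (intro sum.cong refl sum.swap)
    also have "\<dots> = (\<Sum>j\<in>?S. \<Sum>k\<in>?S. if j = k + m then of_nat (?N ^ CARD('d)) * a m else 0)"
    proof (intro sum.cong refl)
      fix j k assume jk: "j \<in> ?S" "k \<in> ?S"
      have "\<bar>(j - k - m) $ i\<bar> < int ?N" for i
        using jk m[of i] unfolding lattice_cube_def by (simp, smt (verit))
      then have "(\<Sum>u\<in>?G. ?\<chi> (j - k - m) u) = (if j - k - m = 0 then of_nat ?N ^ CARD('d) else 0)"
        by (rule sum_grid_character)
      moreover have "j - k - m = 0 \<longleftrightarrow> j = k + m"
        by (auto simp: algebra_simps)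
      ultimately show "(\<Sum>u\<in>?G. a (j - k) * ?\<chi> (j - k - m) u) =
          (if j = k + m then of_nat (?N ^ CARD('d)) * a m else 0)"
        by (simp add: sum_distrib_left[symmetric])
    qed
    also have "\<dots> = (\<Sum>k\<in>?S. \<Sum>j\<in>?S. if j = k + m then of_nat (?N ^ CARD('d)) * a m else 0)"
      by (rule sum.swap)
    also have "\<dots> = (\<Sum>k\<in>?S. if k + m \<in> ?S then of_nat (?N ^ CARD('d)) * a m else 0)"
      by (intro sum.cong refl) (simp add: finite_lattice_cube)
    also have "\<dots> = (\<Sum>k\<in>{k \<in> ?S. k + m \<in> ?S}. of_nat (?N ^ CARD('d)) * a m)"
  by (rule sum.inter_filter[OF finite_lattice_cube, symmetric])
    also have "\<dots> = of_nat (?N ^ CARD('d)) * (a m * of_nat (card {k \<in> ?S. k + m \<in> ?S}))"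
      by simp
    finally show ?thesis .
  qed
  define c where "c = real (?N ^ CARD('d)) * real L ^ CARD('d)"
  have c: "c > 0"
    using L by (simp add: c_def)
  define w where "w u = Re (F u) / c" for u
  have w: "of_real (w u) = F u / of_real c" for u
    using F[of u] by (auto simp: w_def elim: nonneg_Reals_cases)
  show thesis
  proof (rule that)
    show "0 \<le> w u" for u
      using F[of u] c by (auto simp: w_def elim: nonneg_Reals_cases)
    fix m :: "int ^ 'd" assume "\<forall>i. \<bar>m $ i\<bar> \<le> int L"
    then have m: "\<bar>m $ i\<bar> \<le> int L" for i by blast
    have "(\<Prod>i\<in>UNIV. (real L - of_int \<bar>m $ i\<bar>)) =
        (\<Prod>i\<in>(UNIV :: 'd set). real L * (1 - of_int \<bar>m $ i\<bar> / real L))"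
      using L by (intro prod.cong) (auto simp: right_diff_distrib)
    also have "\<dots> = real L ^ CARD('d) * (\<Prod>i\<in>(UNIV :: 'd set). (1 - of_int \<bar>m $ i\<bar> / real L))"
      by (simp add: prod.distrib)
    finally have card: "real (card {k \<in> ?S. k + m \<in> ?S}) =
        real L ^ CARD('d) * (\<Prod>i\<in>UNIV. (1 - of_int \<bar>m $ i\<bar> / real L))"
      using card_lattice_cube_shift[OF m] by simp
    have "(\<Sum>u\<in>?G. of_real (w u) * ?\<chi> (- m) u) = (\<Sum>u\<in>?G. F u * ?\<chi> (- m) u) / of_real c"
      by (simp add: w sum_divide_distrib)
    also have "\<dots> = of_real (?N ^ CARD('d)) * (a m * of_real (real (card {k \<in> ?S. k + m \<in> ?S}))) / of_real c"
      by (simp add: coeff[OF m])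
    also have "\<dots> = a m * of_real (\<Prod>i\<in>UNIV. (1 - of_int \<bar>m $ i\<bar> / real L))"
      unfolding card using L by (simp add: c_def)
    finally show "(\<Sum>u\<in>?G. of_real (w u) * ?\<chi> (- m) u) =
        a m * of_real (\<Prod>i\<in>UNIV. (1 - of_int \<bar>m $ i\<bar> / real L))" .
  qed
qed

section \<open>Herglotz' theorem on the torus\<close>

lemma finite_pmf_with_weights:
  fixes w :: "'a \<Rightarrow> real"
  assumes "finite G" "\<And>u. 0 \<le> w u" "(\<Sum>u\<in>G. w u) = 1"
  obtains p where "set_pmf p \<subseteq> G" "\<And>u. u \<in> G \<Longrightarrow> pmf p u = w u"
proof -
  define v where "v u = (if u \<in> G then w u else 0)" for u
  have nonneg: "0 \<le> v u" for u
    using assms(2) by (simp add: v_def)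
  have "(\<integral>\<^sup>+u. ennreal (v u) \<partial>count_space UNIV) = (\<Sum>u\<in>G. ennreal (v u))"
    using assms(1) by (intro nn_integral_count_space') (auto simp: v_def)
  also have "\<dots> = ennreal (\<Sum>u\<in>G. w u)"
    using assms(2) by (subst sum_ennreal[symmetric]) (auto simp: v_def)
  finally have total: "(\<integral>\<^sup>+u. ennreal (v u) \<partial>count_space UNIV) = 1"
    by (simp add: assms(3))
  show thesis
    using set_embed_pmf[of v, OF nonneg total] pmf_embed_pmf[of v, OF nonneg total]
    by (intro that[of "embed_pmf v"]) (auto simp: v_def split: if_splits)
qed

definition torus_curve :: "real \<Rightarrow> 'd::finite torus"
  where "torus_curve t = (\<chi> i. abs_circle (Schoenberg (\<lambda>k. to_nat (i, k)) t))"

lemma continuous_torus_curve: "continuous_on UNIV torus_curve"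
  unfolding torus_curve_def
  by (intro continuous_on_vec_lambda_UNIV
      continuous_on_compose2[OF continuous_abs_circle continuous_Schoenberg]) simp

text \<open>
  The discrete measures that are lifted along the curve are supported on grid points.
\<close>

lemma torus_curve_hits_grid:
  fixes u :: "'d::finite \<Rightarrow> nat"
  assumes "\<And>i. u i < N"
  obtains t where "0 \<le> t" "t \<le> 1" "\<And>m :: int ^ 'd. character m (torus_curve t) = grid_character N m u"
proof -
  have inj: "inj (\<lambda>(i :: 'd, k :: nat). to_nat (i, k))"
    by (auto simp: inj_on_def)
  have "0 \<le> real (u i) / real N" "real (u i) / real N < 1" for i
    using assms[of i] by (auto simp: divide_simps)
  then obtain t where t: "0 \<le> t" "t \<le> 1"
    "\<And>i. Schoenberg (\<lambda>k. to_nat (i, k)) t = real (u i) / real N"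
    using Schoenberg_space_filling[OF inj, of "\<lambda>i. real (u i) / real N"] by metis
  have "character m (torus_curve t) = grid_character N m u" for m :: "int ^ 'd"
    unfolding character_def grid_character_def torus_curve_def
    by (intro prod.cong refl) (simp add: t(3) circle_character.abs_eq cis_conv_exp mult_ac)
  then show thesis
    using t(1,2) by (intro that)
qed

text \<open>
  The Fejer weights have total mass \<open>a 0\<close>. Normalised, they are transported to parameters at which the
  curve meets the grid points.
\<close>

lemma Herglotz_approximation:
  fixes a :: "int ^ 'd::finite \<Rightarrow> complex"
  assumes a: "positive_definite a" and a0: "a 0 \<noteq> 0" and L: "L > 0"
  obtains M where "real_distribution M" "measure M {0..1} = 1"
    "\<And>m. \<forall>i. \<bar>m $ i\<bar> \<le> int L \<Longrightarrow>
      a 0 * (\<integral>t. character (- m) (torus_curve t) \<partial>M) =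
      a m * of_real (\<Prod>i\<in>UNIV. (1 - of_int \<bar>m $ i\<bar> / real L))"
proof -
  let ?N = "2 * L" and ?G = "PiE (UNIV :: 'd set) (\<lambda>_. {..<2 * L})"
  obtain w :: "('d \<Rightarrow> nat) \<Rightarrow> real" where w: "\<And>u. 0 \<le> w u"
    "\<And>m. \<forall>i. \<bar>m $ i\<bar> \<le> int L \<Longrightarrow>
      (\<Sum>u\<in>?G. of_real (w u) * grid_character ?N (- m) u) =
      a m * of_real (\<Prod>i\<in>UNIV. (1 - of_int \<bar>m $ i\<bar> / real L))"
    using discrete_Fejer_weights[OF a L] by blast
  obtain r where r: "a 0 = of_real r" "r > 0"
    using positive_definite_0[OF a] a0 by (auto elim!: nonneg_Reals_cases)
  have finG: "finite ?G"
    by (intro finite_PiE) auto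
  have "(\<Sum>u\<in>?G. of_real (w u)) = complex_of_real r"
    using w(2)[of 0] by (simp add: r)
  then have "(\<Sum>u\<in>?G. w u) = r"
    by (simp only: of_real_sum[symmetric] of_real_eq_iff)
  then have "(\<Sum>u\<in>?G. w u / r) = 1"
    using r by (simp add: sum_divide_distrib[symmetric])
  then obtain p where p: "set_pmf p \<subseteq> ?G" "\<And>u. u \<in> ?G \<Longrightarrow> pmf p u = w u / r"
    using finite_pmf_with_weights[OF finG, of "\<lambda>u. w u / r"] w(1) r by auto
  have "\<exists>t. 0 \<le> t \<and> t \<le> 1 \<and>
      (\<forall>m :: int ^ 'd. character m (torus_curve t) = grid_character ?N m u)" if "u \<in> ?G" for u
    using that torus_curve_hits_grid[of u ?N] by (metis PiE_mem UNIV_I lessThan_iff)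
  then obtain t where t: "\<And>u. u \<in> ?G \<Longrightarrow> 0 \<le> t u" "\<And>u. u \<in> ?G \<Longrightarrow> t u \<le> 1"
    "\<And>u m. u \<in> ?G \<Longrightarrow> character m (torus_curve (t u)) = grid_character ?N m u"
    by metis
  define M where "M = distr (measure_pmf p) borel t"
  have prob: "prob_space M"
    unfolding M_def by (intro measure_pmf.prob_space_distr) simp
  show thesis
  proof (rule that)
    show "real_distribution M"
      using prob by (simp add: real_distribution_def real_distribution_axioms_def M_def)
    have "measure M {0..1} = measure p (t -` {0..1})"
      by (simp add: M_def measure_distr)
    also have "\<dots> = 1"
      using p(1) t by (intro measure_pmf.prob_eq_1[THEN iffD2] AE_pmfI) auto
    finally show "measure M {0..1} = 1" .
    fix m :: "int ^ 'd" assume m: "\<forall>i. \<bar>m $ i\<bar> \<le> int L"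
    have "(\<lambda>s. character (- m) (torus_curve s)) \<in> borel_measurable borel"
      by (intro borel_measurable_continuous_onI
          continuous_on_compose2[OF continuous_character continuous_torus_curve]) simp
    then have "(\<integral>s. character (- m) (torus_curve s) \<partial>M) =
        (\<integral>u. character (- m) (torus_curve (t u)) \<partial>measure_pmf p)"
      unfolding M_def by (intro integral_distr) auto
    also have "\<dots> = (\<Sum>u\<in>?G. pmf p u *\<^sub>R character (- m) (torus_curve (t u)))"
      using p(1) by (intro integral_measure_pmf finG) auto
    also have "\<dots> = (\<Sum>u\<in>?G. of_real (w u) * grid_character ?N (- m) u) / of_real r"
      using p(2) t(3) by (simp add: sum_divide_distrib scaleR_conv_of_real)
    finally show "a 0 * (\<integral>s. character (- m) (torus_curve s) \<partial>M) =
        a m * of_real (\<Prod>i\<in>UNIV. (1 - of_int \<bar>m $ i\<bar> / real L))"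
      using w(2)[OF m] r by simp
  qed
qed

text \<open>
  This case cannot be normalised to a probability measure. The Fejer weights have total mass zero, so
  all of them vanish, and with them their Fourier coefficients.
\<close>

lemma vanishing_positive_definite:
  fixes a :: "int ^ 'd::finite \<Rightarrow> complex"
  assumes a: "positive_definite a" and a0: "a 0 = 0"
  shows "a m = 0"
proof -
  define L where "L = Suc (\<Sum>i\<in>UNIV. nat \<bar>m $ i\<bar>)"
  have m: "\<bar>m $ i\<bar> < int L" for i
  proof -
    have "nat \<bar>m $ i\<bar> \<le> (\<Sum>i\<in>UNIV. nat \<bar>m $ i\<bar>)"
      by (rule member_le_sum) auto
    then show ?thesis
      unfolding L_def by linarith
  qed
  let ?N = "2 * L" and ?G = "PiE (UNIV :: 'd set) (\<lambda>_. {..<2 * L})"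
  obtain w :: "('d \<Rightarrow> nat) \<Rightarrow> real" where w: "\<And>u. 0 \<le> w u"
    "\<And>m. \<forall>i. \<bar>m $ i\<bar> \<le> int L \<Longrightarrow>
      (\<Sum>u\<in>?G. of_real (w u) * grid_character ?N (- m) u) =
      a m * of_real (\<Prod>i\<in>UNIV. (1 - of_int \<bar>m $ i\<bar> / real L))"
    using discrete_Fejer_weights[OF a, of L] unfolding L_def by blast
  have finG: "finite ?G"
    by (intro finite_PiE) auto
  have "(\<Sum>u\<in>?G. of_real (w u)) = complex_of_real 0"
    using w(2)[of 0] by (simp add: a0)
  then have "(\<Sum>u\<in>?G. w u) = 0"
    by (simp only: of_real_sum[symmetric] of_real_eq_iff)
  then have "w u = 0" if "u \<in> ?G" for u
    using that w(1) by (simp add: sum_nonneg_eq_0_iff[OF finG])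
  then have "a m * of_real (\<Prod>i\<in>UNIV. (1 - of_int \<bar>m $ i\<bar> / real L)) = 0"
    using w(2)[of m] m by (simp add: less_imp_le)
  moreover have "(\<Prod>i\<in>UNIV. (1 - of_int \<bar>m $ i\<bar> / real L)) > 0"
  proof (rule prod_pos)
    fix i
    have "real_of_int \<bar>m $ i\<bar> < real L"
      using m[of i] by linarith
    then show "0 < 1 - of_int \<bar>m $ i\<bar> / real L"
      by (simp add: divide_simps L_def)
  qed
  ultimately show ?thesis
    by (metis mult_eq_0_iff of_real_eq_0_iff less_irrefl)
qed

theorem Herglotz_torus:
  fixes a :: "int ^ 'd::finite \<Rightarrow> complex"
  assumes a: "positive_definite a"
  obtains M where "real_distribution M"
    "\<And>m. a 0 * (\<integral>t. character (- m) (torus_curve t) \<partial>M) = a m"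
proof (cases "a 0 = 0")
  case True
  have "real_distribution (return borel (0 :: real))"
    by (simp add: real_distribution_def real_distribution_axioms_def prob_space_return)
  then show thesis
    using vanishing_positive_definite[OF a True] True by (intro that) auto
next
  case False
  have "\<exists>M. real_distribution M \<and> measure M {0..1} = 1 \<and>
    (\<forall>m. (\<forall>i. \<bar>m $ i\<bar> \<le> int (Suc n)) \<longrightarrow>
      a 0 * (\<integral>t. character (- m) (torus_curve t) \<partial>M) =
      a m * of_real (\<Prod>i\<in>UNIV. (1 - of_int \<bar>m $ i\<bar> / real (Suc n))))" for n
    by (rule Herglotz_approximation[OF a False zero_less_Suc[of n]]) blast
  then obtain M where M: "\<And>n. real_distribution (M n)" "\<And>n. measure (M n) {0..1} = 1"
    "\<And>n m. (\<forall>i. \<bar>m $ i\<bar> \<le> int (Suc n)) \<Longrightarrow>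
      a 0 * (\<integral>t. character (- m) (torus_curve t) \<partial>M n) =
      a m * of_real (\<Prod>i\<in>UNIV. (1 - of_int \<bar>m $ i\<bar> / real (Suc n)))"
    by metis
  have "tight M"
    unfolding tight_def
  proof (intro conjI allI impI)
    fix \<epsilon> :: real assume "\<epsilon> > 0"
    \<comment> \<open>Tightness is stated with left-open intervals, and the parameter \<open>0\<close> may carry mass.\<close>
    have mass: "measure (M n) {-1<..1} \<ge> 1" for n
    proof -
      interpret real_distribution "M n" by (rule M)
      have "measure (M n) {0..1} \<le> measure (M n) {-1<..1}"
        by (intro finite_measure_mono) auto
      then show ?thesis by (simp add: M)
    qed
    have "measure (M n) {-1<..1} > 1 - \<epsilon>" for n
      using \<open>\<epsilon> > 0\<close> mass[of n] by linarith
    then show "\<exists>a b. a < b \<and> (\<forall>n. 1 - \<epsilon> < measure (M n) {a<..b})"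
      by (intro exI[of _ "-1"] exI[of _ 1]) simp
  qed (rule M)
  then obtain r M' where r: "strict_mono (r :: nat \<Rightarrow> nat)" and M': "real_distribution M'"
    and conv: "weak_conv_m (M \<circ> id \<circ> r) M'"
    using tight_imp_convergent_subsubsequence[of M id] by (auto simp: strict_mono_def)
  show thesis
  proof (rule that[OF M'])
    fix m :: "int ^ 'd"
    let ?c = "\<lambda>n. (\<Prod>i\<in>UNIV. (1 - of_int \<bar>m $ i\<bar> / real (Suc n)))"
    have "continuous_on UNIV (\<lambda>t. character (- m) (torus_curve t))"
      by (intro continuous_on_compose2[OF continuous_character continuous_torus_curve]) simp
    then have "(\<lambda>n. \<integral>t. character (- m) (torus_curve t) \<partial>(M \<circ> id \<circ> r) n) \<longlonglongrightarrow>
        (\<integral>t. character (- m) (torus_curve t) \<partial>M')"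
      by (intro weak_conv_imp_integral_bdd_continuous_conv[OF _ M' conv, where B=1])
        (simp_all add: M(1) continuous_on_eq_continuous_at)
    then have "(\<lambda>n. a 0 * (\<integral>t. character (- m) (torus_curve t) \<partial>M (r n))) \<longlonglongrightarrow>
        a 0 * (\<integral>t. character (- m) (torus_curve t) \<partial>M')"
      by (intro tendsto_mult tendsto_const) simp
    moreover have "(\<lambda>n. a 0 * (\<integral>t. character (- m) (torus_curve t) \<partial>M (r n))) \<longlonglongrightarrow> a m"
    proof -
      have "(\<lambda>n. of_int \<bar>m $ i\<bar> / real (Suc n)) \<longlonglongrightarrow> 0" for i
        using LIMSEQ_Suc[OF lim_const_over_n] by simp
      then have "?c \<longlonglongrightarrow> (\<Prod>i\<in>(UNIV :: 'd set). 1 - 0)"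
        by (intro tendsto_prod tendsto_diff tendsto_const)
      then have "(\<lambda>n. a m * of_real (?c n)) \<longlonglongrightarrow> a m * of_real 1"
        by (intro tendsto_mult tendsto_const tendsto_of_real) simp
      then have "(\<lambda>n. a m * of_real (?c n)) \<longlonglongrightarrow> a m" by simp
      moreover have "\<forall>\<^sub>F n in sequentially. a m * of_real (?c n) =
          a 0 * (\<integral>t. character (- m) (torus_curve t) \<partial>M n)"
      proof (rule eventually_sequentiallyI)
        fix n assume n: "(\<Sum>i\<in>UNIV. nat \<bar>m $ i\<bar>) \<le> n"
        have "\<bar>m $ i\<bar> \<le> int (Suc n)" for i
        proof -
          have "nat \<bar>m $ i\<bar> \<le> (\<Sum>i\<in>UNIV. nat \<bar>m $ i\<bar>)"
            by (rule member_le_sum) auto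
          then show ?thesis
            using n by linarith
        qed
        then show "a m * of_real (?c n) = a 0 * (\<integral>t. character (- m) (torus_curve t) \<partial>M n)"
          using M(3)[of m n] by simp
      qed
      ultimately have "(\<lambda>n. a 0 * (\<integral>t. character (- m) (torus_curve t) \<partial>M n)) \<longlonglongrightarrow> a m"
        by (rule Lim_transform_eventually)
      from LIMSEQ_subseq_LIMSEQ[OF this r] show ?thesis
        by (simp add: o_def)
    qed
    ultimately show "a 0 * (\<integral>t. character (- m) (torus_curve t) \<partial>M') = a m"
      by (rule LIMSEQ_unique)
  qed
qed

section \<open>Minimal extrapolation\<close>

text \<open>
  The variation of \<open>\<nu>\<close> is at most \<open>c\<close> times the dominating positive measure, from which \<open>\<nu>\<close> therefore
  inherits finiteness and inner regularity. This covers \<open>\<nu>\<close> and all its modulations at once when \<open>\<nu>\<close> is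
  itself positive.
\<close>

lemma complex_radon_measure_dominated:
  fixes \<nu> :: "'a::topological_space set \<Rightarrow> complex"
  assumes N: "finite_measure N" "sets N = sets borel"
    and inner: "\<And>A \<delta>. A \<in> sets borel \<Longrightarrow> \<delta> > 0 \<Longrightarrow>
      \<exists>K. compact K \<and> K \<in> sets borel \<and> K \<subseteq> A \<and> measure N (A - K) < \<delta>"
    and \<nu>: "borel_sigma_additive \<nu>"
    and le: "\<And>A. A \<in> sets borel \<Longrightarrow> norm (\<nu> A) \<le> c * measure N A" and c: "0 \<le> c"
  shows "\<nu> \<in> complex_radon_measures" "tv_norm \<nu> \<le> c * measure N UNIV"
proof -
  have m: "borel_sigma_additive (\<lambda>A. c * measure N A)"
    by (rule borel_sigma_additive_bounded_linear[OF bounded_linear_mult_right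
          borel_sigma_additive_measure[OF N]])
  have var: "variation \<nu> A \<le> ennreal (c * measure N A)" if "A \<in> sets borel" for A
    by (rule variation_le[OF m le that])
  have "complex_measure \<nu>"
    by (rule complex_measureI[OF \<nu> m le])
  moreover have "\<exists>K. compact K \<and> K \<in> sets borel \<and> K \<subseteq> A \<and> variation \<nu> (A - K) < \<epsilon>"
    if A: "A \<in> sets borel" and \<epsilon>: "\<epsilon> > 0" for A \<epsilon>
  proof -
    obtain y where y: "0 < y" "y < \<epsilon>"
      using dense[OF \<epsilon>] by blast
    then obtain r where r: "y = ennreal r" "r > 0"
      by (cases y) auto
    \<comment> \<open>The denominator is \<open>c + 1\<close> because \<open>c\<close> may be zero.\<close>
    obtain K where K: "compact K" "K \<in> sets borel" "K \<subseteq> A" "measure N (A - K) < r / (c + 1)"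
      using inner[OF A, of "r / (c + 1)"] r c by auto
    have "c * measure N (A - K) \<le> (c + 1) * measure N (A - K)"
      by (intro mult_right_mono) auto
    also have "\<dots> \<le> r"
      using K(4) c by (simp add: field_simps)
    finally have "variation \<nu> (A - K) \<le> ennreal r"
      using var[of "A - K"] A K(2) by (meson ennreal_leI order_trans sets.Diff)
    then show ?thesis
      using K y r by (auto intro: le_less_trans)
  qed
  ultimately show "\<nu> \<in> complex_radon_measures"
    by (auto simp: complex_radon_measures_def complex_measure_def borel_sigma_additive_def)
  show "tv_norm \<nu> \<le> c * measure N UNIV"
    unfolding tv_norm_def using var[of UNIV] c by (intro enn2real_leI) auto
qed

text \<open>
  Compact subsets of the preimage of \<open>A\<close> on the line are mapped to compact subsets of \<open>A\<close>, which are
  Borel sets because they are closed.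
\<close>

lemma image_measure_inner_regular:
  fixes \<Gamma> :: "real \<Rightarrow> 'd::finite torus"
  assumes M: "real_distribution M" and \<Gamma>: "continuous_on UNIV \<Gamma>"
    and A: "A \<in> sets borel" and \<delta>: "\<delta> > 0"
  shows "\<exists>K. compact K \<and> K \<in> sets borel \<and> K \<subseteq> A \<and> measure (distr M borel \<Gamma>) (A - K) < \<delta>"
proof -
  interpret real_distribution M by fact
  have \<Gamma>_meas: "\<Gamma> \<in> measurable M borel"
    using borel_measurable_continuous_onI[OF \<Gamma>] by simp
  define B where "B = \<Gamma> -` A"
  have B: "B \<in> sets borel"
    using measurable_sets[OF borel_measurable_continuous_onI[OF \<Gamma>] A] by (simp add: B_def)
  have "\<exists>K. compact K \<and> K \<subseteq> B \<and> measure M B - \<delta> < measure M K"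
  proof (rule ccontr)
    assume "\<not> ?thesis"
    then have le: "measure M K \<le> measure M B - \<delta>" if "compact K" "K \<subseteq> B" for K
      using that by (meson not_less)
    have nonneg: "0 \<le> measure M B - \<delta>"
      using le[of "{}"] by simp
    have "emeasure M B = (SUP K \<in> {K. K \<subseteq> B \<and> compact K}. emeasure M K)"
      using B by (intro inner_regular) auto
    also have "\<dots> \<le> ennreal (measure M B - \<delta>)"
      by (intro SUP_least) (auto simp: emeasure_eq_measure intro!: ennreal_leI le)
    finally show False
      using nonneg \<delta> by (simp add: emeasure_eq_measure ennreal_le_iff)
  qed
  then obtain K where K: "compact K" "K \<subseteq> B" "measure M B - \<delta> < measure M K"
    by blast
  have Kb: "K \<in> sets borel"
    using K(1) by (intro borel_closed compact_imp_closed)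
  have cpt: "compact (\<Gamma> ` K)"
    using K(1) continuous_on_subset[OF \<Gamma>] by (intro compact_continuous_image) auto
  then have \<Gamma>K: "\<Gamma> ` K \<in> sets borel"
    by (intro borel_closed compact_imp_closed_torus)
  have "measure (distr M borel \<Gamma>) (A - \<Gamma> ` K) = measure M (\<Gamma> -` (A - \<Gamma> ` K))"
    using A \<Gamma>K by (subst measure_distr[OF \<Gamma>_meas]) auto
  also have "\<dots> \<le> measure M (B - K)"
    using B Kb by (intro finite_measure_mono) (auto simp: B_def)
  also have "\<dots> = measure M B - measure M K"
    using B Kb K(2) by (intro finite_measure_Diff) auto
  also have "\<dots> < \<delta>"
    using K(3) by simp
  finally have "measure (distr M borel \<Gamma>) (A - \<Gamma> ` K) < \<delta>" .
  then show ?thesis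
    using cpt \<Gamma>K K(2) by (intro exI[of _ "\<Gamma> ` K"]) (auto simp: B_def)
qed

lemma modulation_eq:
  "modulation n \<mu> = (\<lambda>A. complex_integral \<mu> (\<lambda>x. indicator A x * character n x))"
  by (rule ext) (simp add: modulation_def)

text \<open>
  Modulating by the character \<open>n\<close> translates the Fourier transform by \<open>n\<close>.
\<close>

lemma fourier_modulation:
  assumes "complex_measure \<mu>"
  shows "fourier (modulation n \<mu>) m = fourier \<mu> (m - n)"
proof -
  have "(\<lambda>x. character (- m) x * character n x) = character (- (m - n))"
    by (rule ext) (simp add: character_add[symmetric])
  then show ?thesis
    unfolding fourier_def modulation_eq
    by (simp add: complex_integral_density[OF assms bounded_borel_character bounded_borel_character])
qed

lemma norm_fourier_le:
  assumes "complex_measure \<mu>"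
  shows "norm (fourier \<mu> m) \<le> tv_norm \<mu>"
  using norm_complex_integral_le[OF assms bounded_borel_character, of "- m" 1]
  by (simp add: fourier_def)

text \<open>
  The Herglotz measure is kept as \<open>a 0\<close> times a probability measure, which covers \<open>a 0 = 0\<close> uniformly.
  Modulation does not increase the norm because a character times an indicator is bounded by the
  indicator.
\<close>

lemma positive_definite_representation:
  fixes a :: "int ^ 'd::finite \<Rightarrow> complex"
  assumes a: "positive_definite a"
  obtains \<nu> where "\<nu> \<in> complex_radon_measures" "positive_measure \<nu>" "\<And>m. fourier \<nu> m = a m"
    "\<And>n. modulation n \<nu> \<in> complex_radon_measures" "\<And>n. tv_norm (modulation n \<nu>) \<le> norm (a 0)"
proof -
  obtain M where M: "real_distribution M"
    and coeff: "\<And>m. a 0 * (\<integral>t. character (- m) (torus_curve t) \<partial>M) = a m"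
    using Herglotz_torus[OF a] by blast
  interpret M: real_distribution M by fact
  obtain r where r: "a 0 = of_real r" "r \<ge> 0"
    using positive_definite_0[OF a] by (rule nonneg_Reals_cases)
  define N where "N = distr M borel (torus_curve :: real \<Rightarrow> 'd torus)"
  have curve: "torus_curve \<in> measurable M (borel :: 'd torus measure)"
    by (simp add: measurable_cong_sets[OF M.events_eq_borel refl]
        borel_measurable_continuous_onI[OF continuous_torus_curve])
  have "prob_space N"
    unfolding N_def by (rule M.prob_space_distr[OF curve])
  then have N: "finite_measure N" "sets N = sets borel" "measure N UNIV = 1"
    using prob_space.prob_space[of N] by (auto simp: N_def prob_space.finite_measure)
  define \<nu> where "\<nu> A = complex_of_real (r * measure N A)" for A
  have \<nu>_add: "borel_sigma_additive \<nu>"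
    unfolding \<nu>_def
    by (intro borel_sigma_additive_bounded_linear[OF bounded_linear_of_real]
        borel_sigma_additive_bounded_linear[OF bounded_linear_mult_right]
        borel_sigma_additive_measure N)
  have \<nu>_norm: "norm (\<nu> A) \<le> r * measure N A" for A
    using r by (simp add: \<nu>_def norm_mult)
  have inner: "\<exists>K. compact K \<and> K \<in> sets borel \<and> K \<subseteq> A \<and> measure N (A - K) < \<delta>"
    if "A \<in> sets borel" "\<delta> > 0" for A \<delta>
    unfolding N_def by (rule image_measure_inner_regular[OF M continuous_torus_curve that])
  have \<nu>: "\<nu> \<in> complex_radon_measures"
    by (rule complex_radon_measure_dominated(1)[OF N(1,2) inner \<nu>_add \<nu>_norm r(2)])
  note \<nu>_cm = complex_radon_measure_imp_complex_measure[OF \<nu>]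
  have integral: "complex_integral \<nu> f = a 0 * (\<integral>x. f x \<partial>N)" if f: "bounded_borel f" for f
  proof (rule complex_integral_eqI[OF \<nu>_cm _ _ f])
    show "bounded_functional (\<lambda>f. a 0 * integral\<^sup>L N f)"
      using bounded_functional_lincomb[OF bounded_functional_integral[OF N(1,2)]
          bounded_functional_integral[OF N(1,2)], of "a 0" 0] by simp
    show "a 0 * integral\<^sup>L N (indicator A) = \<nu> A" if "A \<in> sets borel" for A
      using integral_complex_of_real[of N "indicator A"] sets_eq_imp_space_eq[OF N(2)]
      by (simp add: of_real_indicator \<nu>_def r)
  qed
  have fourier: "fourier \<nu> m = a m" for m
  proof -
    have "(\<integral>x. character (- m) x \<partial>N) = (\<integral>t. character (- m) (torus_curve t) \<partial>M)"
      unfolding N_def using bounded_borel_character[of "- m"]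
      by (intro integral_distr curve) (simp add: bounded_borel_def)
    then show ?thesis
      unfolding fourier_def integral[OF bounded_borel_character] using coeff by simp
  qed
  have mod_add: "borel_sigma_additive (modulation n \<nu>)" for n
    using complex_measure_density[OF \<nu>_cm bounded_borel_character]
    unfolding modulation_eq complex_measure_def by blast
  have mod_norm: "norm (modulation n \<nu> A) \<le> r * measure N A" if A: "A \<in> sets borel" for n A
  proof -
    have "bounded_borel (\<lambda>x. indicator A x * character n x)"
      using A by (intro bounded_borel_mult bounded_borel_indicator bounded_borel_character)
    then have "norm (modulation n \<nu> A) = r * norm (\<integral>x. indicator A x * character n x \<partial>N)"
      by (simp add: modulation_eq integral norm_mult r)
    also have "\<dots> \<le> r * (\<integral>x. norm (indicator A x * character n x) \<partial>N)"
      using r by (intro mult_left_mono integral_norm_bound)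
    also have "(\<integral>x. norm (indicator A x * character n x) \<partial>N) = (\<integral>x. indicator A x \<partial>N)"
      by (intro Bochner_Integration.integral_cong refl) (simp add: norm_mult indicator_def)
    also have "\<dots> = measure N A"
      using sets_eq_imp_space_eq[OF N(2)] by simp
    finally show ?thesis .
  qed
  show thesis
  proof (rule that)
    show "positive_measure \<nu>"
      using r by (simp add: positive_measure_def \<nu>_def del: of_real_mult)
    show "tv_norm (modulation n \<nu>) \<le> norm (a 0)" for n
    proof -
      have "tv_norm (modulation n \<nu>) \<le> r * measure N UNIV"
        by (rule complex_radon_measure_dominated(2)[OF N(1,2) inner mod_add mod_norm r(2)])
      then show ?thesis
        using r N(3) by simp
    qed
    show "modulation n \<nu> \<in> complex_radon_measures" for n
      by (rule complex_radon_measure_dominated(1)[OF N(1,2) inner mod_add mod_norm r(2)])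
  qed (use \<nu> fourier in auto)
qed

theorem proposition2p8:
  fixes \<mu> :: "'d::finite torus set \<Rightarrow> complex"
    and \<Lambda> :: "(int ^ 'd) set"
    and n :: "int ^ 'd"
  assumes "\<mu> \<in> complex_radon_measures"
    and "finite \<Lambda>"
    and "n \<in> \<Lambda>"
    and "\<exists>a. positive_definite a \<and>
          extends_from (fourier (modulation (- n) \<mu>)) ((\<lambda>m. m - n) ` \<Lambda>) a"
  shows "n \<in> Gamma_set \<mu> \<Lambda> \<and>
    (\<forall>a. positive_definite a \<and>
         extends_from (fourier (modulation (- n) \<mu>)) ((\<lambda>m. m - n) ` \<Lambda>) a \<longrightarrow>
      (\<exists>\<nu>. \<nu> \<in> complex_radon_measures \<and> positive_measure \<nu> \<and>
           (\<forall>m. fourier \<nu> m = a m) \<and>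
           minimal_extrapolation \<mu> \<Lambda> (modulation n \<nu>)))"
proof -
  have \<mu>: "complex_measure \<mu>"
    by (rule complex_radon_measure_imp_complex_measure[OF assms(1)])
  have lower: "norm (fourier \<mu> n) \<le> tv_norm \<nu>'" if "\<nu>' \<in> extrapolations \<mu> \<Lambda>" for \<nu>'
    using that norm_fourier_le[of \<nu>' n] assms(3)
    by (auto simp: extrapolations_def dest: complex_radon_measure_imp_complex_measure)
  have *: "\<exists>\<nu>. \<nu> \<in> complex_radon_measures \<and> positive_measure \<nu> \<and> (\<forall>m. fourier \<nu> m = a m) \<and>
      modulation n \<nu> \<in> extrapolations \<mu> \<Lambda> \<and> tv_norm (modulation n \<nu>) \<le> norm (fourier \<mu> n)"
    if a: "positive_definite a"
      and ext: "extends_from (fourier (modulation (- n) \<mu>)) ((\<lambda>m. m - n) ` \<Lambda>) a" for a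
  proof -
    have a_\<Lambda>: "a (m - n) = fourier \<mu> m" if "m \<in> \<Lambda>" for m
      using ext that by (simp add: extends_from_def fourier_modulation[OF \<mu>])
    obtain \<nu> where \<nu>: "\<nu> \<in> complex_radon_measures" "positive_measure \<nu>" "\<And>m. fourier \<nu> m = a m"
      "modulation n \<nu> \<in> complex_radon_measures" "tv_norm (modulation n \<nu>) \<le> norm (a 0)"
      using positive_definite_representation[OF a] by metis
    have "modulation n \<nu> \<in> extrapolations \<mu> \<Lambda>"
      using \<nu>(3,4) a_\<Lambda> fourier_modulation[OF complex_radon_measure_imp_complex_measure[OF \<nu>(1)]]
      by (simp add: extrapolations_def)
    moreover have "a 0 = fourier \<mu> n"
      using a_\<Lambda>[OF assms(3)] by simp
    ultimately show ?thesis
      using \<nu> by auto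
  qed
  obtain \<nu>\<^sub>0 where \<nu>\<^sub>0: "\<nu>\<^sub>0 \<in> extrapolations \<mu> \<Lambda>" "tv_norm \<nu>\<^sub>0 \<le> norm (fourier \<mu> n)"
    using assms(4) * by blast
  have "minimal_norm \<mu> \<Lambda> = norm (fourier \<mu> n)"
    unfolding minimal_norm_def
  proof (rule cInf_eq_minimum)
    show "norm (fourier \<mu> n) \<in> tv_norm ` extrapolations \<mu> \<Lambda>"
      using \<nu>\<^sub>0 lower[OF \<nu>\<^sub>0(1)] by (intro image_eqI[of _ _ \<nu>\<^sub>0]) auto
  qed (use lower in auto)
  then have "n \<in> Gamma_set \<mu> \<Lambda>"
    using assms(3) by (simp add: Gamma_set_def)
  moreover have "minimal_extrapolation \<mu> \<Lambda> \<nu>'"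
    if "\<nu>' \<in> extrapolations \<mu> \<Lambda>" "tv_norm \<nu>' \<le> norm (fourier \<mu> n)" for \<nu>'
    using that lower by (auto simp: minimal_extrapolation_def intro: order_trans)
  ultimately show ?thesis
    using * by blast
qed

end
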